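(* The trilinear operator $\mathcal{T}$ is bounded from $L^2(\mathbb{R}^2)\times L^2(\mathbb{R}^2)\times L^2(\mathbb{R}^2)$ to $L^2(\mathbb{R}^2)$, and from $\dot X^1(\mathbb{R}^2)\times\dot X^1(\mathbb{R}^2)\times\dot X^1(\mathbb{R}^2)$ to $\dot X^1(\mathbb{R}^2)$.
   Context: For complex-valued functions $f,g,h$ on $\mathbb{R}^2$, $$\mathcal{T}(f,g,h)(\xi)=\int_{-1}^1\int_{\mathbb{R}^2}f(\xi+x)\,\overline{g(\xi+x+\lambda x^\perp)}\,h(\xi+\lambda x^\perp)\,dx\,d\lambda,$$ where $x^\perp$ is the rotation of $x\in\mathbb{R}^2$ by $+\pi/2$. ("Trilinear" allows antilinearity in the middle argument.) $\dot X^1(\mathbb{R}^2)=\{f:\ |x|f(x)\in L^\infty(\mathbb{R}^2)\}$ with norm $\||x|f\|_{L^\infty}$. *)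

theory Defs
  imports "HOL-Analysis.Analysis" "HOL-Probability.Essential_Supremum"
begin

text \<open>
  Elements of \<open>L\<^sup>2\<close> and of the weighted \<open>L\<^sup>\<infinity>\<close> space are represented by Lebesgue measurable
  functions, not by equivalence classes; equations between them are stated almost everywhere.
\<close>

type_synonym plane_fun = "real ^ 2 \<Rightarrow> complex"

definition perp :: "real ^ 2 \<Rightarrow> real ^ 2" where
  "perp x = vector [- (x $ 2), x $ 1]"

definition T_integrand ::
    "plane_fun \<Rightarrow> plane_fun \<Rightarrow> plane_fun \<Rightarrow> real ^ 2 \<Rightarrow> real \<Rightarrow> real ^ 2 \<Rightarrow> complex" where
  "T_integrand f g h \<xi> l x =
     f (\<xi> + x) * cnj (g (\<xi> + x + l *\<^sub>R perp x)) * h (\<xi> + l *\<^sub>R perp x)"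

definition T_op :: "plane_fun \<Rightarrow> plane_fun \<Rightarrow> plane_fun \<Rightarrow> plane_fun" where
  "T_op f g h \<xi> = (LINT l:{-1..1}|lebesgue. (LINT x|lebesgue. T_integrand f g h \<xi> l x))"

text \<open>
  The Bochner integral is \<open>0\<close> where the integrand is not integrable, so convergence of the
  integral defining \<open>T_op f g h \<xi>\<close> has to be expressed separately.
\<close>

definition T_converges :: "plane_fun \<Rightarrow> plane_fun \<Rightarrow> plane_fun \<Rightarrow> real ^ 2 \<Rightarrow> bool" where
  "T_converges f g h \<xi> \<longleftrightarrow>
     set_integrable lebesgue ({-1..1} \<times> UNIV) (\<lambda>(l, x). T_integrand f g h \<xi> l x)"

definition L2_space :: "plane_fun set" where
  "L2_space = {f. f \<in> borel_measurable lebesgue \<and> integrable lebesgue (\<lambda>x. (cmod (f x))\<^sup>2)}"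

definition L2_norm :: "plane_fun \<Rightarrow> real" where
  "L2_norm f = sqrt (LINT x|lebesgue. (cmod (f x))\<^sup>2)"

definition X1_enorm :: "plane_fun \<Rightarrow> ereal" where
  "X1_enorm f = esssup lebesgue (\<lambda>x. ereal (norm x * cmod (f x)))"

definition X1_space :: "plane_fun set" where
  "X1_space = {f. f \<in> borel_measurable lebesgue \<and> X1_enorm f < \<infinity>}"

definition X1_norm :: "plane_fun \<Rightarrow> real" where
  "X1_norm f = real_of_ereal (X1_enorm f)"

text \<open>
  Trilinearity is understood in the loose sense: complex linear in the outer
  arguments and antilinear in the middle one. Together with the norm bound it makes \<open>S\<close>
  well defined on almost-everywhere equivalence classes.
\<close>

definition trilinear_on ::
    "plane_fun set \<Rightarrow> (plane_fun \<Rightarrow> plane_fun \<Rightarrow> plane_fun \<Rightarrow> plane_fun) \<Rightarrow> bool" where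
  "trilinear_on V S \<longleftrightarrow>
     (\<forall>f\<in>V. \<forall>f'\<in>V. \<forall>g\<in>V. \<forall>h\<in>V. \<forall>c.
        (AE \<xi> in lebesgue. S (\<lambda>x. c * f x + f' x) g h \<xi> = c * S f g h \<xi> + S f' g h \<xi>) \<and>
        (AE \<xi> in lebesgue. S g (\<lambda>x. c * f x + f' x) h \<xi> = cnj c * S g f h \<xi> + S g f' h \<xi>) \<and>
        (AE \<xi> in lebesgue. S g h (\<lambda>x. c * f x + f' x) \<xi> = c * S g h f \<xi> + S g h f' \<xi>))"

definition bounded_trilinear_on ::
    "plane_fun set \<Rightarrow> (plane_fun \<Rightarrow> real) \<Rightarrow>
       (plane_fun \<Rightarrow> plane_fun \<Rightarrow> plane_fun \<Rightarrow> plane_fun) \<Rightarrow> bool" where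
  "bounded_trilinear_on V N S \<longleftrightarrow>
     trilinear_on V S \<and>
     (\<forall>f\<in>V. \<forall>g\<in>V. \<forall>h\<in>V. S f g h \<in> V) \<and>
     (\<exists>C. \<forall>f\<in>V. \<forall>g\<in>V. \<forall>h\<in>V. N (S f g h) \<le> C * N f * N g * N h)"

end

theory Submission
  imports Defs
begin

text \<open>
  Write \<open>J\<close> for the rotation \<open>perp\<close>. The points \<open>\<xi>\<close>, \<open>\<xi> + x\<close>, \<open>\<xi> + x + l J x\<close> and
  \<open>\<xi> + l J x\<close> are the vertices of a rectangle, and \<open>\<alpha> + \<beta> J\<close> is a similarity of the plane with
  Jacobian \<open>\<alpha>\<^sup>2 + \<beta>\<^sup>2\<close>. Both bounds hold for the positive operator \<open>T_majorant\<close>, obtained by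
  moving absolute values inside the integral; its finiteness at \<open>\<xi>\<close> is the convergence
  of the integral there. Since every substitution involved is an invertible similarity
  (for \<open>l \<noteq> 0\<close>), changing an argument on a null set alters neither the operator
  nor convergence at any point, so Borel representatives may be used throughout.

  For \<open>L\<^sup>2\<close>, the Cauchy--Schwarz inequality in \<open>(l, x)\<close> pairs the factor \<open>g\<close> against the product of
  \<open>f\<close> and \<open>h\<close>. For fixed \<open>l\<close> the square of the first integrates in \<open>x\<close> to
  \<open>\<parallel>g\<parallel>\<^sup>2 / (1 + l\<^sup>2)\<close>; the square of the second integrates in \<open>(x, \<xi>)\<close> to
  \<open>\<parallel>f\<parallel>\<^sup>2 \<parallel>h\<parallel>\<^sup>2 / (1 + l\<^sup>2)\<close>, because \<open>(\<xi> + x, \<xi> + l J x)\<close> are linear coordinates on pairs of points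
  (\<open>nn_integral_orthogonal_pair\<close>). Both are bounded over \<open>l \<in> [-1, 1]\<close>.

  For the weighted space one has to show that the integral of \<open>1 / (a b c)\<close> is \<open>O(1 / \<bar>\<xi>\<bar>)\<close>, with
  \<open>a\<close>, \<open>b\<close>, \<open>c\<close> the norms of \<open>\<xi> + x\<close>, \<open>\<xi> + l J x\<close>, \<open>\<xi> + x + l J x\<close>. The British flag theorem
  \<open>a\<^sup>2 + b\<^sup>2 = c\<^sup>2 + \<bar>\<xi>\<bar>\<^sup>2\<close> gives \<open>a + b \<ge> max \<bar>\<xi>\<bar> c\<close>, which splits the kernel into two terms with only two
  singularities each but with cubic decay at infinity (\<open>rectangle_kernel_split\<close>). In the
  coordinate \<open>y = \<xi> + x + l J x\<close> the singularities sit at \<open>0\<close> and at a point at distance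
  \<open>\<bar>l\<bar> \<bar>\<xi>\<bar>\<close> or \<open>\<bar>\<xi>\<bar> / \<bar>l\<bar>\<close> from it. The true size of the integral in \<open>x\<close> is logarithmic in \<open>l\<close>;
  giving up half a power of that distance yields the cruder factor \<open>1 / sqrt \<bar>l\<bar>\<close>
  (\<open>nn_integral_rectangle_kernel\<close>), which is still integrable on \<open>[-1, 1]\<close>.
\<close>

section \<open>Similarities of the plane\<close>

lemma perp_nth [simp]: "perp x $ 1 = - (x $ 2)" "perp x $ 2 = x $ 1"
  by (simp_all add: perp_def)

lemma linear_perp: "linear perp"
  by (rule linearI) (simp_all add: vec_eq_iff forall_2)

lemma perp_perp [simp]: "perp (perp x) = - x"
  by (simp add: vec_eq_iff forall_2)

lemma norm_perp [simp]: "norm (perp x) = norm x"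
  by (simp add: norm_eq_sqrt_inner inner_vec_def sum_2)

lemma inner_perp [simp]: "x \<bullet> perp x = 0"
  by (simp add: inner_vec_def sum_2)

lemma perp_add: "perp (x + y) = perp x + perp y" and perp_diff: "perp (x - y) = perp x - perp y"
  and perp_scaleR: "perp (c *\<^sub>R x) = c *\<^sub>R perp x"
  using linear_perp by (simp_all add: linear_add linear_diff linear_scale)

lemma norm_similarity: "norm (x + l *\<^sub>R perp x) = sqrt (1 + l\<^sup>2) * norm x"
proof (rule power2_eq_imp_eq)
  have "perp x \<bullet> x = 0" by (simp add: inner_commute)
  hence "(norm (x + l *\<^sub>R perp x))\<^sup>2 = x \<bullet> x + l\<^sup>2 * (perp x \<bullet> perp x)"
    by (simp only: power2_norm_eq_inner) (simp add: inner_add_left inner_add_right power2_eq_square)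
  also have "\<dots> = (sqrt (1 + l\<^sup>2) * norm x)\<^sup>2"
    by (simp only: power2_norm_eq_inner[symmetric] norm_perp) (simp add: power_mult_distrib distrib_right)
  finally show "(norm (x + l *\<^sub>R perp x))\<^sup>2 = (sqrt (1 + l\<^sup>2) * norm x)\<^sup>2" .
qed auto

lemma borel_measurable_perp [measurable (raw)]:
  assumes "w \<in> borel_measurable M"
  shows "(\<lambda>y. perp (w y)) \<in> borel_measurable M"
proof -
  have "continuous_on UNIV perp"
    using linear_perp by (intro linear_continuous_on) (simp add: linear_conv_bounded_linear)
  thus ?thesis using assms by (rule borel_measurable_continuous_on)
qed

text \<open>
  By uniqueness of Lebesgue measure it is enough to compare boxes; the preimage of a box is
  measurable, and its image under \<open>A\<close> is the box again.
\<close>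
lemma distr_lborel_linear:
  fixes A :: "(real, 'n::{finite,wellorder}) vec \<Rightarrow> (real, 'n::{finite,wellorder}) vec"
  assumes A: "linear A" and det: "det (matrix A) \<noteq> 0"
  shows "density (distr lborel borel A) (\<lambda>_. ennreal \<bar>det (matrix A)\<bar>) = lborel"
proof (rule lborel_eqI[symmetric])
  have [measurable]: "A \<in> borel_measurable borel"
    using A by (intro borel_measurable_continuous_onI linear_continuous_on) (simp add: linear_conv_bounded_linear)
  have "inj A" using det_nz_iff_inj[OF A] det by simp
  then obtain B where B: "linear B" "B \<circ> A = id"
    using linear_injective_left_inverse[OF A] by auto
  hence "A \<circ> B = id"
    using linear_inverse_left[OF A B(1)] by simp
  note B = B this
  fix l u :: "(real, 'n) vec"
  assume le: "\<And>b. b \<in> Basis \<Longrightarrow> l \<bullet> b \<le> u \<bullet> b"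
  have vim: "A -` box l u = B ` box l u"
    using B by (auto simp: image_iff fun_eq_iff) (metis)
  have "open (A -` box l u)" 
    using A by (intro open_vimage open_box linear_continuous_on) (simp add: linear_conv_bounded_linear)
  hence bor [measurable]: "A -` box l u \<in> sets borel" by simp
  have lm: "A -` box l u \<in> lmeasurable"
    unfolding vim by (intro measurable_linear_image B) auto
  have "measure lebesgue (A ` (A -` box l u)) = \<bar>det (matrix A)\<bar> * measure lebesgue (A -` box l u)"
    by (rule measure_linear_image[OF A lm])
  moreover have "A ` (A -` box l u) = box l u"
    using B by (auto simp: vim image_iff fun_eq_iff) 
  ultimately have *: "\<bar>det (matrix A)\<bar> * measure lborel (A -` box l u) = measure lborel (box l u)"
    by (simp add: measure_completion)
  have fin: "emeasure lborel (A -` box l u) \<noteq> \<infinity>" 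
    using lm unfolding fmeasurable_def by (auto simp: emeasure_completion)
  have "emeasure (density (distr lborel borel A) (\<lambda>_. ennreal \<bar>det (matrix A)\<bar>)) (box l u)
     = ennreal \<bar>det (matrix A)\<bar> * emeasure lborel (A -` box l u)"
    by (simp add: emeasure_density_const emeasure_distr)
  also have "\<dots> = ennreal (\<bar>det (matrix A)\<bar> * measure lborel (A -` box l u))"
    using fin by (simp add: emeasure_eq_ennreal_measure ennreal_mult')
  also have "\<dots> = emeasure lborel (box l u)"
    unfolding * using emeasure_lborel_box_finite[of l u]
    by (intro emeasure_eq_ennreal_measure[symmetric]) auto
  also have "\<dots> = (\<Prod>b\<in>Basis. (u - l) \<bullet> b)" using le by (simp add: emeasure_lborel_box)
  finally show "emeasure (density (distr lborel borel A) (\<lambda>_. ennreal \<bar>det (matrix A)\<bar>)) (box l u)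
    = (\<Prod>b\<in>Basis. (u - l) \<bullet> b)" .
qed simp

lemma nn_integral_lborel_similarity:
  fixes F :: "real ^ 2 \<Rightarrow> ennreal"
  assumes [measurable]: "F \<in> borel_measurable borel" and ne: "\<alpha> \<noteq> 0 \<or> \<beta> \<noteq> 0"
  shows "(\<integral>\<^sup>+x. F (a + \<alpha> *\<^sub>R x + \<beta> *\<^sub>R perp x) \<partial>lborel) = (\<integral>\<^sup>+x. F x \<partial>lborel) / ennreal (\<alpha>\<^sup>2 + \<beta>\<^sup>2)"
proof -
  define A where "A = (\<lambda>x. \<alpha> *\<^sub>R x + \<beta> *\<^sub>R perp x)"
  have A: "linear A" unfolding A_def 
    by (intro linear_compose_add linear_compose_scale_right linear_perp linear_ident)
  have [measurable]: "A \<in> borel_measurable borel" unfolding A_def by measurable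
  have d: "det (matrix A) = \<alpha>\<^sup>2 + \<beta>\<^sup>2"
    by (simp add: det_2 matrix_def A_def axis_def power2_eq_square)
  have pos: "0 < \<alpha>\<^sup>2 + \<beta>\<^sup>2" using ne by (simp add: sum_power2_gt_zero_iff)
  have "(\<integral>\<^sup>+x. F x \<partial>lborel) = (\<integral>\<^sup>+x. F x \<partial>(distr lborel borel ((+) a)))"
    by (simp add: lborel_distr_plus)
  also have "\<dots> = (\<integral>\<^sup>+x. F (a + x) \<partial>lborel)"
    by (subst nn_integral_distr) auto
  also have "\<dots> = (\<integral>\<^sup>+x. F (a + x) \<partial>(density (distr lborel borel A) (\<lambda>_. ennreal \<bar>det (matrix A)\<bar>)))"
    using d pos by (subst distr_lborel_linear[OF A]) auto
  also have "\<dots> = ennreal (\<alpha>\<^sup>2 + \<beta>\<^sup>2) * (\<integral>\<^sup>+x. F (a + A x) \<partial>lborel)"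
    by (simp add: nn_integral_density nn_integral_distr nn_integral_cmult d)
  finally have "(\<integral>\<^sup>+x. F x \<partial>lborel) / ennreal (\<alpha>\<^sup>2 + \<beta>\<^sup>2)
      = (\<integral>\<^sup>+x. F (a + A x) \<partial>lborel) * ennreal (\<alpha>\<^sup>2 + \<beta>\<^sup>2) / ennreal (\<alpha>\<^sup>2 + \<beta>\<^sup>2)"
    by (simp only: mult.commute)
  also have "\<dots> = (\<integral>\<^sup>+x. F (a + A x) \<partial>lborel)"
    using pos by (intro mult_divide_eq_ennreal) (simp_all add: ennreal_eq_0_iff del: ennreal_plus)
  finally show ?thesis by (simp add: A_def add.assoc)
qed

section \<open>The positive majorant and passage to Borel representatives\<close>

lemma borel_measurable_cnj [measurable (raw)]:
  "w \<in> borel_measurable M \<Longrightarrow> (\<lambda>y. cnj (w y)) \<in> borel_measurable M"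
  by (rule borel_measurable_continuous_on[of cnj]) (intro continuous_intros)

lemma T_integrand_measurable [measurable (raw)]:
  assumes [measurable]: "f \<in> borel_measurable borel" "g \<in> borel_measurable borel" "h \<in> borel_measurable borel"
    and [measurable]: "u \<in> M \<rightarrow>\<^sub>M borel" "v \<in> M \<rightarrow>\<^sub>M borel" "w \<in> M \<rightarrow>\<^sub>M borel"
  shows "(\<lambda>y. T_integrand f g h (u y) (v y) (w y)) \<in> borel_measurable M"
  unfolding T_integrand_def by measurable

text \<open>
  An iterated integral with values in the extended nonnegative reals, so that it makes sense
  before any convergence is known.
\<close>
definition T_majorant :: "plane_fun \<Rightarrow> plane_fun \<Rightarrow> plane_fun \<Rightarrow> real ^ 2 \<Rightarrow> ennreal" where
  "T_majorant f g h \<xi> =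
     (\<integral>\<^sup>+l. indicator {-1..1} l * (\<integral>\<^sup>+x. ennreal (cmod (T_integrand f g h \<xi> l x)) \<partial>lborel) \<partial>lborel)"

lemma T_majorant_measurable:
  assumes [measurable]: "f \<in> borel_measurable borel" "g \<in> borel_measurable borel" "h \<in> borel_measurable borel"
  shows "T_majorant f g h \<in> borel_measurable borel"
  unfolding T_majorant_def[abs_def] by measurable

lemma T_converges_iff_integrable:
  assumes [measurable]: "f \<in> borel_measurable borel" "g \<in> borel_measurable borel" "h \<in> borel_measurable borel"
  shows "T_converges f g h \<xi> \<longleftrightarrow>
    integrable (lborel \<Otimes>\<^sub>M lborel) (\<lambda>p. indicator {-1..1} (fst p) *\<^sub>R T_integrand f g h \<xi> (fst p) (snd p))"
proof -
  have "T_converges f g h \<xi> \<longleftrightarrow> integrable lebesgue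
     (\<lambda>p. indicator {-1..1} (fst p) *\<^sub>R T_integrand f g h \<xi> (fst p) (snd p))"
    unfolding T_converges_def set_integrable_def
    by (intro Bochner_Integration.integrable_cong) (auto simp: indicator_def)
  also have "\<dots> \<longleftrightarrow> integrable (lborel :: (real \<times> (real ^ 2)) measure) 
     (\<lambda>p. indicator {-1..1} (fst p) *\<^sub>R T_integrand f g h \<xi> (fst p) (snd p))"
    by (intro integrable_completion) (simp add: borel_prod[symmetric])
  finally show ?thesis by (simp add: lborel_prod)
qed

lemma T_converges_iff_majorant:
  assumes [measurable]: "f \<in> borel_measurable borel" "g \<in> borel_measurable borel" "h \<in> borel_measurable borel"
  shows "T_converges f g h \<xi> \<longleftrightarrow> T_majorant f g h \<xi> < \<infinity>"
proof -
  have "(\<integral>\<^sup>+p. ennreal (norm (indicator {-1..1} (fst p) *\<^sub>R T_integrand f g h \<xi> (fst p) (snd p))) \<partial>(lborel \<Otimes>\<^sub>M lborel))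
    = (\<integral>\<^sup>+l. \<integral>\<^sup>+x. ennreal (norm (indicator {-1..1} l *\<^sub>R T_integrand f g h \<xi> l x)) \<partial>lborel \<partial>lborel)"
    by (subst lborel.nn_integral_fst[symmetric]) auto
  also have "\<dots> = T_majorant f g h \<xi>"
    unfolding T_majorant_def
    by (intro nn_integral_cong) (auto simp: indicator_def)
  finally show ?thesis
    unfolding T_converges_iff_integrable[OF assms] by (simp add: integrable_iff_bounded)
qed

lemma T_op_lborel:
  assumes [measurable]: "f \<in> borel_measurable borel" "g \<in> borel_measurable borel" "h \<in> borel_measurable borel"
  shows "T_op f g h \<xi> =
    (LINT l|lborel. indicator {-1..1} l *\<^sub>R (LINT x|lborel. T_integrand f g h \<xi> l x))"
proof -
  have "T_op f g h \<xi> = (LINT l|lebesgue. indicator {-1..1} l *\<^sub>R (LINT x|lborel. T_integrand f g h \<xi> l x))"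
    unfolding T_op_def set_lebesgue_integral_def by (simp add: integral_completion)
  thus ?thesis by (simp add: integral_completion)
qed

lemma T_op_measurable:
  assumes [measurable]: "f \<in> borel_measurable borel" "g \<in> borel_measurable borel" "h \<in> borel_measurable borel"
  shows "T_op f g h \<in> borel_measurable borel"
proof -
  have "(\<lambda>\<xi>. (LINT l|lborel. indicator {-1..1} l *\<^sub>R (LINT x|lborel. T_integrand f g h \<xi> l x))) \<in> borel_measurable borel"
    by measurable
  thus ?thesis using T_op_lborel[OF assms] by (metis (mono_tags, lifting) measurable_cong)
qed

text \<open>
  Fubini's theorem; without convergence the iterated integral and the integral over the
  product may differ.
\<close>
lemma T_op_eq_integral:
  assumes [measurable]: "f \<in> borel_measurable borel" "g \<in> borel_measurable borel" "h \<in> borel_measurable borel"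
    and conv: "T_converges f g h \<xi>"
  shows "T_op f g h \<xi> =
    (LINT p|(lborel \<Otimes>\<^sub>M lborel). indicator {-1..1} (fst p) *\<^sub>R T_integrand f g h \<xi> (fst p) (snd p))"
proof -
  have "(LINT p|(lborel \<Otimes>\<^sub>M lborel). indicator {-1..1} (fst p) *\<^sub>R T_integrand f g h \<xi> (fst p) (snd p))
    = (LINT l|lborel. LINT x|lborel. indicator {-1..1} l *\<^sub>R T_integrand f g h \<xi> l x)"
    using lborel_pair.integral_fst'[OF conv[unfolded T_converges_iff_integrable[OF assms(1-3)]]] by simp
  thus ?thesis by (simp add: T_op_lborel)
qed

text \<open>
  A non-integrable function has Bochner integral \<open>0\<close>, so the bound is unconditional.
\<close>
lemma nn_integral_norm_bound:
  fixes f :: "'a \<Rightarrow> 'b::{banach, second_countable_topology}"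
  shows "ennreal (norm (integral\<^sup>L M f)) \<le> (\<integral>\<^sup>+x. ennreal (norm (f x)) \<partial>M)"
  by (cases "integrable M f") (auto simp: integral_norm_bound_ennreal not_integrable_integral_eq)

lemma T_op_le_majorant:
  assumes [measurable]: "f \<in> borel_measurable borel" "g \<in> borel_measurable borel" "h \<in> borel_measurable borel"
  shows "ennreal (cmod (T_op f g h \<xi>)) \<le> T_majorant f g h \<xi>"
proof -
  have "ennreal (cmod (T_op f g h \<xi>)) \<le>
     (\<integral>\<^sup>+l. ennreal (norm (indicator {-1..1} l *\<^sub>R (LINT x|lborel. T_integrand f g h \<xi> l x))) \<partial>lborel)"
    unfolding T_op_lborel[OF assms] by (rule nn_integral_norm_bound)
  also have "\<dots> \<le> T_majorant f g h \<xi>"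
    unfolding T_majorant_def
    by (intro nn_integral_mono) (auto simp: indicator_def nn_integral_norm_bound)
  finally show ?thesis .
qed

text \<open>
  Completeness of Lebesgue measure supplies the measurability of \<open>F\<close>.
\<close>
lemma lebesgue_integral_AE_cong:
  fixes F G :: "'a::euclidean_space \<Rightarrow> 'b::euclidean_space"
  assumes G: "G \<in> borel_measurable borel" and ae: "AE x in lborel. F x = G x"
  shows "integrable lebesgue F \<longleftrightarrow> integrable lebesgue G" 
    and "integral\<^sup>L lebesgue F = integral\<^sup>L lebesgue G"
proof -
  have G': "G \<in> borel_measurable lebesgue" using G by (simp add: measurable_completion)
  have ae': "AE x in lebesgue. F x = G x" using ae by (rule AE_completion)
  have F': "F \<in> borel_measurable lebesgue" 
    by (rule borel_measurable_AE[OF G']) (use ae' in \<open>auto elim: AE_mp\<close>)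
  show "integrable lebesgue F \<longleftrightarrow> integrable lebesgue G" 
    by (rule integrable_cong_AE[OF F' G' ae'])
  show "integral\<^sup>L lebesgue F = integral\<^sup>L lebesgue G"
    by (rule integral_cong_AE[OF F' G' ae'])
qed

lemma AE_lborel_similarity:
  assumes P: "AE y in lborel. P y" and ne: "\<alpha> \<noteq> 0 \<or> \<beta> \<noteq> 0"
  shows "AE x in lborel. P (a + \<alpha> *\<^sub>R x + \<beta> *\<^sub>R perp x)"
proof -
  from P obtain N where N: "N \<in> null_sets lborel" "{y. \<not> P y} \<subseteq> N"
    by (auto simp: eventually_ae_filter)
  have [measurable]: "N \<in> sets borel" using N by auto
  have "(\<integral>\<^sup>+x. indicator N (a + \<alpha> *\<^sub>R x + \<beta> *\<^sub>R perp x) \<partial>lborel) = 0"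
    using N by (subst nn_integral_lborel_similarity[OF _ ne]) auto
  hence "AE x in lborel. indicator N (a + \<alpha> *\<^sub>R x + \<beta> *\<^sub>R perp x) = (0::ennreal)"
    by (subst (asm) nn_integral_0_iff_AE) auto
  thus ?thesis by eventually_elim (use N in \<open>auto simp: indicator_def split: if_splits\<close>)
qed

text \<open>
  The exclusion of \<open>l = 0\<close> is essential: there the third factor is constantly \<open>h \<xi>\<close>.
\<close>
lemma AE_T_integrand_cong:
  assumes f: "AE x in lborel. f x = f' x" and g: "AE x in lborel. g x = g' x" and h: "AE x in lborel. h x = h' x"
    and l: "l \<noteq> 0"
  shows "AE x in lborel. T_integrand f g h \<xi> l x = T_integrand f' g' h' \<xi> l x"
proof -
  have "AE x in lborel. f (\<xi> + x) = f' (\<xi> + x)"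
    using AE_lborel_similarity[OF f, of 1 0 \<xi>] by simp
  moreover have "AE x in lborel. g (\<xi> + x + l *\<^sub>R perp x) = g' (\<xi> + x + l *\<^sub>R perp x)"
    using AE_lborel_similarity[OF g, of 1 l \<xi>] by simp
  moreover have "AE x in lborel. h (\<xi> + l *\<^sub>R perp x) = h' (\<xi> + l *\<^sub>R perp x)"
    using AE_lborel_similarity[OF h, of 0 l \<xi>] l by simp
  ultimately show ?thesis by eventually_elim (simp add: T_integrand_def)
qed

text \<open>
  The exceptional set is enlarged to a Borel null set, whose pullback is measurable on the
  product, so that it may be checked slice by slice in \<open>l\<close>.
\<close>
lemma AE_pair_T_integrand_cong:
  assumes f: "AE x in lborel. f x = f' x" and g: "AE x in lborel. g x = g' x" and h: "AE x in lborel. h x = h' x"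
  shows "AE p in lborel. T_integrand f g h \<xi> (fst p) (snd p) = T_integrand f' g' h' \<xi> (fst p) (snd p)"
proof -
  have "AE x in lborel. f x = f' x \<and> g x = g' x \<and> h x = h' x" using f g h by eventually_elim auto
  then obtain N where N: "N \<in> null_sets lborel" "{x. \<not> (f x = f' x \<and> g x = g' x \<and> h x = h' x)} \<subseteq> N"
    unfolding eventually_ae_filter by auto
  have [measurable]: "N \<in> sets borel" using N by auto
  have ae: "AE x in lborel. x \<notin> N" using N by (auto intro: AE_not_in)
  let ?P = "\<lambda>p. \<xi> + snd p \<notin> N \<and> \<xi> + snd p + fst p *\<^sub>R perp (snd p) \<notin> N \<and> \<xi> + fst p *\<^sub>R perp (snd p) \<notin> N"
  have "AE p in (lborel \<Otimes>\<^sub>M lborel). ?P p"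
  proof (rule lborel_pair.AE_pair_measure)
    show "{p \<in> space (lborel \<Otimes>\<^sub>M lborel). ?P p} \<in> sets (lborel \<Otimes>\<^sub>M lborel)" by measurable
    have "AE x in lborel. ?P (l, x)" if "l \<noteq> 0" for l :: real
    proof -
      have "AE x in lborel. \<xi> + x \<notin> N"
        using AE_lborel_similarity[OF ae, of 1 0 \<xi>] by simp
      moreover have "AE x in lborel. \<xi> + x + l *\<^sub>R perp x \<notin> N"
        using AE_lborel_similarity[OF ae, of 1 l \<xi>] by simp
      moreover have "AE x in lborel. \<xi> + l *\<^sub>R perp x \<notin> N"
        using AE_lborel_similarity[OF ae, of 0 l \<xi>] that by simp
      ultimately show ?thesis by eventually_elim simp
    qed
    with AE_lborel_singleton[of "0::real"] show "AE l in lborel. AE x in lborel. ?P (l, x)"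
      by (auto elim!: eventually_mono)
  qed
  hence avoid: "AE p in lborel. ?P p" by (simp only: lborel_prod)
  have same: "f x = f' x" "g x = g' x" "h x = h' x" if "x \<notin> N" for x
    using N(2) that by auto
  from avoid show ?thesis
    by eventually_elim (simp add: T_integrand_def same)
qed

text \<open>
  The equality holds at every \<open>\<xi>\<close>, not only almost everywhere: for fixed \<open>\<xi>\<close> the integrands
  agree for almost all \<open>(l, x)\<close>, and the inner integrals agree for all \<open>l \<noteq> 0\<close>.
\<close>
lemma
  assumes [measurable]: "f' \<in> borel_measurable borel" "g' \<in> borel_measurable borel" "h' \<in> borel_measurable borel"
    and f: "AE x in lborel. f x = f' x" and g: "AE x in lborel. g x = g' x" and h: "AE x in lborel. h x = h' x"
  shows T_converges_AE_cong: "T_converges f g h \<xi> \<longleftrightarrow> T_converges f' g' h' \<xi>"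
    and T_op_AE_cong: "T_op f g h \<xi> = T_op f' g' h' \<xi>"
proof -
  note ae = AE_pair_T_integrand_cong[OF f g h, of \<xi>]
  have [measurable]: "(\<lambda>p. T_integrand f' g' h' \<xi> (fst p) (snd p)) \<in> borel_measurable borel"
    by (simp add: borel_prod[symmetric])
  show "T_converges f g h \<xi> \<longleftrightarrow> T_converges f' g' h' \<xi>"
    unfolding T_converges_def set_integrable_def case_prod_unfold
  proof (rule lebesgue_integral_AE_cong(1))
    have "({-1..1} \<times> UNIV :: (real \<times> (real ^ 2)) set) \<in> sets borel"
      by (intro borel_closed closed_Times) auto
    thus "(\<lambda>p. indicat_real ({-1..1} \<times> UNIV) p *\<^sub>R T_integrand f' g' h' \<xi> (fst p) (snd p)) \<in> borel_measurable borel"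
      by measurable
  qed (use ae in \<open>auto elim!: eventually_mono\<close>)
  have 1: "(LINT x|lebesgue. T_integrand f g h \<xi> l x) = (LINT x|lebesgue. T_integrand f' g' h' \<xi> l x)" 
    if "l \<noteq> 0" for l
    by (rule lebesgue_integral_AE_cong(2)[OF _ AE_T_integrand_cong[OF f g h that]]) measurable
  show "T_op f g h \<xi> = T_op f' g' h' \<xi>"
    unfolding T_op_def set_lebesgue_integral_def
  proof (rule lebesgue_integral_AE_cong(2))
    have "(\<lambda>l. indicat_real {- 1..1} l *\<^sub>R (LINT x|lborel. T_integrand f' g' h' \<xi> l x)) \<in> borel_measurable borel"
      by measurable
    thus "(\<lambda>l. indicat_real {- 1..1} l *\<^sub>R (LINT x|lebesgue. T_integrand f' g' h' \<xi> l x)) \<in> borel_measurable borel"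
      by (simp add: integral_completion)
  qed (use AE_lborel_singleton[of "0::real"] 1 in \<open>auto elim!: eventually_mono\<close>)
qed

lemma lebesgue_borel_representative:
  fixes f :: "'a::euclidean_space \<Rightarrow> complex"
  assumes "f \<in> borel_measurable lebesgue"
  obtains f' where "f' \<in> borel_measurable borel" "AE x in lborel. f x = f' x"
proof -
  obtain u where u: "u \<in> borel_measurable lborel" "AE x in lborel. Re (f x) = u x"
    using completion_ex_borel_measurable_real[of "\<lambda>x. Re (f x)" lborel] assms by auto
  obtain v where v: "v \<in> borel_measurable lborel" "AE x in lborel. Im (f x) = v x"
    using completion_ex_borel_measurable_real[of "\<lambda>x. Im (f x)" lborel] assms by auto
  show ?thesis
  proof
    show "(\<lambda>x. Complex (u x) (v x)) \<in> borel_measurable borel"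
      using u v by (simp add: borel_measurable_complex_iff)
    show "AE x in lborel. f x = Complex (u x) (v x)"
      using u(2) v(2) by eventually_elim (simp add: complex_eq_iff)
  qed
qed

text \<open>
  Linearity of the integral is used on the product space: absolute convergence there makes the
  two combined integrals additive, while the inner integrals alone might diverge for some \<open>l\<close>.
\<close>
lemma T_op_linear_combination:
  assumes [measurable]: "f \<in> borel_measurable borel" "g \<in> borel_measurable borel" "h \<in> borel_measurable borel"
    and [measurable]: "f' \<in> borel_measurable borel" "g' \<in> borel_measurable borel" "h' \<in> borel_measurable borel"
    and [measurable]: "f'' \<in> borel_measurable borel" "g'' \<in> borel_measurable borel" "h'' \<in> borel_measurable borel"
    and conv: "T_converges f g h \<xi>" "T_converges f' g' h' \<xi>"
    and eq: "\<And>l x. T_integrand f'' g'' h'' \<xi> l x = c * T_integrand f g h \<xi> l x + T_integrand f' g' h' \<xi> l x"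
  shows "T_op f'' g'' h'' \<xi> = c * T_op f g h \<xi> + T_op f' g' h' \<xi>"
proof -
  let ?I = "\<lambda>f g h p. indicat_real {- 1..1} (fst p) *\<^sub>R T_integrand f g h \<xi> (fst p) (snd p)"
  let ?M = "lborel \<Otimes>\<^sub>M lborel :: (real \<times> (real ^ 2)) measure"
  have I: "integrable ?M (?I f g h)" "integrable ?M (?I f' g' h')"
    using conv by (simp_all add: T_converges_iff_integrable)
  have eqI: "?I f'' g'' h'' = (\<lambda>p. c * ?I f g h p + ?I f' g' h' p)"
    by (simp add: eq fun_eq_iff scaleR_add_right)
  have "T_converges f'' g'' h'' \<xi>"
    unfolding T_converges_iff_integrable[OF assms(7-9)] eqI
    using I by (intro Bochner_Integration.integrable_add integrable_mult_right)
  hence "T_op f'' g'' h'' \<xi> = (LINT p|?M. c * ?I f g h p + ?I f' g' h' p)"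
    by (simp only: T_op_eq_integral[OF assms(7-9)] eqI)
  also have "\<dots> = c * T_op f g h \<xi> + T_op f' g' h' \<xi>"
    unfolding T_op_eq_integral[OF assms(1-3) conv(1)] T_op_eq_integral[OF assms(4-6) conv(2)]
    using I by (simp only: Bochner_Integration.integral_add integrable_mult_right integral_mult_right_zero)
  finally show ?thesis .
qed

text \<open>
  Where all the integrals converge, linearity in each slot is inherited from the integrand;
  Borel representatives of the arguments make Fubini's theorem available.
\<close>
lemma trilinear_on_T_op:
  assumes meas: "\<And>f. f \<in> V \<Longrightarrow> f \<in> borel_measurable lebesgue"
    and conv: "\<And>f g h. f \<in> V \<Longrightarrow> g \<in> V \<Longrightarrow> h \<in> V \<Longrightarrow> AE \<xi> in lebesgue. T_converges f g h \<xi>"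
  shows "trilinear_on V T_op"
  unfolding trilinear_on_def
proof (intro ballI allI conjI)
  fix f f' g h c assume V: "f \<in> V" "f' \<in> V" "g \<in> V" "h \<in> V"
  obtain F where F [measurable]: "F \<in> borel_measurable borel" and aF: "AE x in lborel. f x = F x"
    using lebesgue_borel_representative[OF meas[OF V(1)]] by blast
  obtain F' where F' [measurable]: "F' \<in> borel_measurable borel" and aF': "AE x in lborel. f' x = F' x"
    using lebesgue_borel_representative[OF meas[OF V(2)]] by blast
  obtain G where G [measurable]: "G \<in> borel_measurable borel" and aG: "AE x in lborel. g x = G x"
    using lebesgue_borel_representative[OF meas[OF V(3)]] by blast
  obtain H where H [measurable]: "H \<in> borel_measurable borel" and aH: "AE x in lborel. h x = H x"
    using lebesgue_borel_representative[OF meas[OF V(4)]] by blast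
  define K where "K = (\<lambda>x. c * F x + F' x)"
  have K [measurable]: "K \<in> borel_measurable borel" unfolding K_def by measurable
  have aK: "AE x in lborel. c * f x + f' x = K x"
    using aF aF' by eventually_elim (simp add: K_def)
  show "AE \<xi> in lebesgue. T_op (\<lambda>x. c * f x + f' x) g h \<xi> = c * T_op f g h \<xi> + T_op f' g h \<xi>"
    using conv[OF V(1,3,4)] conv[OF V(2,3,4)]
  proof eventually_elim
    case (elim \<xi>)
    show ?case
      unfolding T_op_AE_cong[OF F G H aF aG aH] T_op_AE_cong[OF F' G H aF' aG aH]
        T_op_AE_cong[OF K G H aK aG aH]
      by (rule T_op_linear_combination)
        (use elim T_converges_AE_cong[OF F G H aF aG aH] T_converges_AE_cong[OF F' G H aF' aG aH]
          in \<open>auto simp: T_integrand_def K_def algebra_simps\<close>)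
  qed
  show "AE \<xi> in lebesgue. T_op g (\<lambda>x. c * f x + f' x) h \<xi> = cnj c * T_op g f h \<xi> + T_op g f' h \<xi>"
    using conv[OF V(3,1,4)] conv[OF V(3,2,4)]
  proof eventually_elim
    case (elim \<xi>)
    show ?case
      unfolding T_op_AE_cong[OF G F H aG aF aH] T_op_AE_cong[OF G F' H aG aF' aH]
        T_op_AE_cong[OF G K H aG aK aH]
      by (rule T_op_linear_combination)
        (use elim T_converges_AE_cong[OF G F H aG aF aH] T_converges_AE_cong[OF G F' H aG aF' aH]
          in \<open>auto simp: T_integrand_def K_def algebra_simps\<close>)
  qed
  show "AE \<xi> in lebesgue. T_op g h (\<lambda>x. c * f x + f' x) \<xi> = c * T_op g h f \<xi> + T_op g h f' \<xi>"
    using conv[OF V(3,4,1)] conv[OF V(3,4,2)]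
  proof eventually_elim
    case (elim \<xi>)
    show ?case
      unfolding T_op_AE_cong[OF G H F aG aH aF] T_op_AE_cong[OF G H F' aG aH aF']
        T_op_AE_cong[OF G H K aG aH aK]
      by (rule T_op_linear_combination)
        (use elim T_converges_AE_cong[OF G H F aG aH aF] T_converges_AE_cong[OF G H F' aG aH aF']
          in \<open>auto simp: T_integrand_def K_def algebra_simps\<close>)
  qed
qed

section \<open>The square-integrable case\<close>

text \<open>
  The map \<open>(\<xi>, x) \<mapsto> (\<xi> + x, \<xi> + l J x)\<close> has Jacobian \<open>1 + l\<^sup>2\<close>. It is carried out in two
  steps: first \<open>a = \<xi> + x\<close> for fixed \<open>x\<close>, then the similarity \<open>x \<mapsto> a - x + l J x\<close> for fixed \<open>a\<close>.
\<close>
lemma nn_integral_orthogonal_pair: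
  fixes F H :: "real ^ 2 \<Rightarrow> ennreal"
  assumes [measurable]: "F \<in> borel_measurable borel" "H \<in> borel_measurable borel"
  shows "(\<integral>\<^sup>+\<xi>. \<integral>\<^sup>+x. F (\<xi> + x) * H (\<xi> + l *\<^sub>R perp x) \<partial>lborel \<partial>lborel)
    = (\<integral>\<^sup>+x. F x \<partial>lborel) * (\<integral>\<^sup>+x. H x \<partial>lborel) / ennreal (1 + l\<^sup>2)"
proof -
  have "(\<integral>\<^sup>+\<xi>. \<integral>\<^sup>+x. F (\<xi> + x) * H (\<xi> + l *\<^sub>R perp x) \<partial>lborel \<partial>lborel)
    = (\<integral>\<^sup>+x. \<integral>\<^sup>+\<xi>. F (\<xi> + x) * H (\<xi> + l *\<^sub>R perp x) \<partial>lborel \<partial>lborel)"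
    by (rule lborel_pair.Fubini') measurable
  also have "\<dots> = (\<integral>\<^sup>+x. \<integral>\<^sup>+a. F a * H (a + (-1) *\<^sub>R x + l *\<^sub>R perp x) \<partial>lborel \<partial>lborel)"
  proof (rule nn_integral_cong)
    fix x :: "real ^ 2"
    have "(\<integral>\<^sup>+a. F a * H (a + (-1) *\<^sub>R x + l *\<^sub>R perp x) \<partial>lborel)
        = (\<integral>\<^sup>+a. F a * H (a + (-1) *\<^sub>R x + l *\<^sub>R perp x) \<partial>(distr lborel borel ((+) x)))"
      by (simp only: lborel_distr_plus)
    also have "\<dots> = (\<integral>\<^sup>+\<xi>. F (\<xi> + x) * H (\<xi> + l *\<^sub>R perp x) \<partial>lborel)"
      by (subst nn_integral_distr) (auto simp: add.commute)
    finally show "(\<integral>\<^sup>+\<xi>. F (\<xi> + x) * H (\<xi> + l *\<^sub>R perp x) \<partial>lborel)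
        = (\<integral>\<^sup>+a. F a * H (a + (-1) *\<^sub>R x + l *\<^sub>R perp x) \<partial>lborel)" ..
  qed
  also have "\<dots> = (\<integral>\<^sup>+a. \<integral>\<^sup>+x. F a * H (a + (-1) *\<^sub>R x + l *\<^sub>R perp x) \<partial>lborel \<partial>lborel)"
    by (rule lborel_pair.Fubini') measurable
  also have "\<dots> = (\<integral>\<^sup>+a. F a * ((\<integral>\<^sup>+x. H x \<partial>lborel) / ennreal (1 + l\<^sup>2)) \<partial>lborel)"
  proof (rule nn_integral_cong)
    fix a :: "real ^ 2"
    show "(\<integral>\<^sup>+x. F a * H (a + (-1) *\<^sub>R x + l *\<^sub>R perp x) \<partial>lborel)
      = F a * ((\<integral>\<^sup>+x. H x \<partial>lborel) / ennreal (1 + l\<^sup>2))"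
      using nn_integral_lborel_similarity[of H "-1" l a] by (subst nn_integral_cmult) auto
  qed
  also have "\<dots> = (\<integral>\<^sup>+x. F x \<partial>lborel) * (\<integral>\<^sup>+x. H x \<partial>lborel) / ennreal (1 + l\<^sup>2)"
    by (subst nn_integral_multc) (simp_all add: ennreal_times_divide del: ennreal_plus)
  finally show ?thesis .
qed

lemma ennreal_divide_le_self:
  fixes a b :: ennreal
  assumes "1 \<le> b"
  shows "a / b \<le> a"
proof -
  have "0 < b" using assms by (auto intro: less_le_trans[of 0 1])
  moreover have "a \<le> b * a" using mult_right_mono[OF assms, of a] by simp
  ultimately show ?thesis by (rule divide_le_posI_ennreal)
qed

text \<open>
  The factor \<open>4\<close> is the square of the length of \<open>[-1, 1]\<close>, which enters once through each
  Cauchy--Schwarz factor.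
\<close>
lemma nn_integral_T_majorant_squared_le:
  assumes [measurable]: "f \<in> borel_measurable borel" "g \<in> borel_measurable borel" "h \<in> borel_measurable borel"
  shows "(\<integral>\<^sup>+\<xi>. (T_majorant f g h \<xi>)\<^sup>2 \<partial>lborel) \<le>
     4 * ((\<integral>\<^sup>+x. (ennreal (cmod (f x)))\<^sup>2 \<partial>lborel) * (\<integral>\<^sup>+x. (ennreal (cmod (g x)))\<^sup>2 \<partial>lborel) *
      (\<integral>\<^sup>+x. (ennreal (cmod (h x)))\<^sup>2 \<partial>lborel))"
proof -
  define F where "F = (\<lambda>x. ennreal (cmod (f x)))"
  define G where "G = (\<lambda>x. ennreal (cmod (g x)))"
  define H where "H = (\<lambda>x. ennreal (cmod (h x)))"
  have [measurable]: "F \<in> borel_measurable borel" "G \<in> borel_measurable borel" "H \<in> borel_measurable borel"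
    unfolding F_def G_def H_def by measurable
  let ?N = "\<lambda>F. (\<integral>\<^sup>+x. (F x)\<^sup>2 \<partial>lborel) :: ennreal"
  let ?J = "\<lambda>\<xi>. \<integral>\<^sup>+l. indicator {-1..1} l * (\<integral>\<^sup>+x. (F (\<xi> + x))\<^sup>2 * (H (\<xi> + l *\<^sub>R perp x))\<^sup>2 \<partial>lborel) \<partial>lborel"
  have len: "(\<integral>\<^sup>+l. indicator {-1..1::real} l * c \<partial>lborel) = 2 * c" for c :: ennreal
    by (simp add: nn_integral_multc)
  have le: "c / ennreal (1 + l\<^sup>2) \<le> c" for c and l :: real
    by (rule ennreal_divide_le_self) (simp add: one_ennreal_def[symmetric] del: ennreal_plus ennreal_1)
  have pt: "(T_majorant f g h \<xi>)\<^sup>2 \<le> ?J \<xi> * (2 * ?N G)" for \<xi>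
  proof -
    \<comment> \<open>The squared indicator is the indicator, so each factor may carry one.\<close>
    let ?\<Phi> = "\<lambda>p. indicator {-1..1::real} (fst p) * (F (\<xi> + snd p) * H (\<xi> + fst p *\<^sub>R perp (snd p)))"
    let ?\<Psi> = "\<lambda>p. indicator {-1..1::real} (fst p) * G (\<xi> + snd p + fst p *\<^sub>R perp (snd p))"
    have "T_majorant f g h \<xi> = (\<integral>\<^sup>+l. \<integral>\<^sup>+x. ?\<Phi> (l, x) * ?\<Psi> (l, x) \<partial>lborel \<partial>lborel)"
      unfolding T_majorant_def F_def G_def H_def T_integrand_def
      by (intro nn_integral_cong) (auto simp: indicator_def norm_mult ennreal_mult mult_ac)
    also have "\<dots> = (\<integral>\<^sup>+p. ?\<Phi> p * ?\<Psi> p \<partial>(lborel \<Otimes>\<^sub>M lborel))"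
      by (rule lborel.nn_integral_fst) measurable
    finally have "(T_majorant f g h \<xi>)\<^sup>2 \<le>
      (\<integral>\<^sup>+p. (?\<Phi> p)\<^sup>2 \<partial>(lborel \<Otimes>\<^sub>M lborel)) * (\<integral>\<^sup>+p. (?\<Psi> p)\<^sup>2 \<partial>(lborel \<Otimes>\<^sub>M lborel))"
      by (simp only:) (rule Cauchy_Schwarz_nn_integral; measurable)
    also have "(\<integral>\<^sup>+p. (?\<Phi> p)\<^sup>2 \<partial>(lborel \<Otimes>\<^sub>M lborel)) = (\<integral>\<^sup>+l. \<integral>\<^sup>+x. (?\<Phi> (l, x))\<^sup>2 \<partial>lborel \<partial>lborel)"
      by (rule lborel.nn_integral_fst[symmetric]) measurable
    also have "\<dots> = ?J \<xi>"
      by (intro nn_integral_cong) (auto simp: indicator_def power_mult_distrib)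
    also have "(\<integral>\<^sup>+p. (?\<Psi> p)\<^sup>2 \<partial>(lborel \<Otimes>\<^sub>M lborel)) = (\<integral>\<^sup>+l. \<integral>\<^sup>+x. (?\<Psi> (l, x))\<^sup>2 \<partial>lborel \<partial>lborel)"
      by (rule lborel.nn_integral_fst[symmetric]) measurable
    also have "\<dots> \<le> (\<integral>\<^sup>+l. indicator {-1..1::real} l * ?N G \<partial>lborel)"
    proof (rule nn_integral_mono)
      fix l :: real
      have "(\<integral>\<^sup>+x. (G (\<xi> + x + l *\<^sub>R perp x))\<^sup>2 \<partial>lborel) = ?N G / ennreal (1 + l\<^sup>2)"
        using nn_integral_lborel_similarity[of "\<lambda>x. (G x)\<^sup>2" 1 l \<xi>] by simp
      thus "(\<integral>\<^sup>+x. (?\<Psi> (l, x))\<^sup>2 \<partial>lborel) \<le> indicator {-1..1} l * ?N G"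
        using le[of "?N G" l] by (auto simp: indicator_def)
    qed
    also have "\<dots> = 2 * ?N G" by (rule len)
    finally show ?thesis by (simp add: mult_left_mono)
  qed
  have "(\<integral>\<^sup>+\<xi>. ?J \<xi> \<partial>lborel) = (\<integral>\<^sup>+l. \<integral>\<^sup>+\<xi>. indicator {-1..1::real} l *
      (\<integral>\<^sup>+x. (F (\<xi> + x))\<^sup>2 * (H (\<xi> + l *\<^sub>R perp x))\<^sup>2 \<partial>lborel) \<partial>lborel \<partial>lborel)"
    by (rule lborel_pair.Fubini') measurable
  also have "\<dots> = (\<integral>\<^sup>+l. indicator {-1..1::real} l * (?N F * ?N H / ennreal (1 + l\<^sup>2)) \<partial>lborel)"
    by (intro nn_integral_cong, subst nn_integral_cmult)
      (simp_all add: nn_integral_orthogonal_pair[of "\<lambda>x. (F x)\<^sup>2" "\<lambda>x. (H x)\<^sup>2"] del: ennreal_plus)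
  also have "\<dots> \<le> (\<integral>\<^sup>+l. indicator {-1..1::real} l * (?N F * ?N H) \<partial>lborel)"
    by (intro nn_integral_mono mult_left_mono le) auto
  also have "\<dots> = 2 * (?N F * ?N H)" by (rule len)
  finally have J: "(\<integral>\<^sup>+\<xi>. ?J \<xi> \<partial>lborel) \<le> 2 * (?N F * ?N H)" .
  have "(\<integral>\<^sup>+\<xi>. (T_majorant f g h \<xi>)\<^sup>2 \<partial>lborel) \<le> (\<integral>\<^sup>+\<xi>. ?J \<xi> * (2 * ?N G) \<partial>lborel)"
    by (intro nn_integral_mono pt)
  also have "\<dots> = (\<integral>\<^sup>+\<xi>. ?J \<xi> \<partial>lborel) * (2 * ?N G)"
    by (rule nn_integral_multc) measurable
  also have "\<dots> \<le> 2 * (?N F * ?N H) * (2 * ?N G)"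
    using J by (intro mult_right_mono) auto
  also have "\<dots> = (2 * 2) * (?N F * ?N G * ?N H)" by (simp only: mult_ac)
  finally show ?thesis by (simp add: F_def G_def H_def)
qed

lemma nn_integral_square_eq_L2_norm:
  assumes "f \<in> L2_space" "AE x in lborel. f x = f' x"
  shows "(\<integral>\<^sup>+x. (ennreal (cmod (f' x)))\<^sup>2 \<partial>lborel) = ennreal ((L2_norm f)\<^sup>2)"
proof -
  have int: "integrable lebesgue (\<lambda>x. (cmod (f x))\<^sup>2)" using assms by (simp add: L2_space_def)
  have "(\<integral>\<^sup>+x. (ennreal (cmod (f' x)))\<^sup>2 \<partial>lborel) = (\<integral>\<^sup>+x. ennreal ((cmod (f x))\<^sup>2) \<partial>lborel)"
    using assms(2) by (intro nn_integral_cong_AE) (auto elim!: eventually_mono simp: ennreal_power)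
  also have "\<dots> = (\<integral>\<^sup>+x. ennreal ((cmod (f x))\<^sup>2) \<partial>lebesgue)"
    by (simp add: nn_integral_completion)
  also have "\<dots> = ennreal (LINT x|lebesgue. (cmod (f x))\<^sup>2)"
    by (rule nn_integral_eq_integral[OF int]) simp
  also have "(LINT x|lebesgue. (cmod (f x))\<^sup>2) = (L2_norm f)\<^sup>2"
    unfolding L2_norm_def by (subst real_sqrt_pow2) (auto intro: integral_nonneg)
  finally show ?thesis .
qed

lemma L2_norm_nonneg: "0 \<le> L2_norm f"
  by (simp add: L2_norm_def integral_nonneg)

lemma L2_estimate:
  assumes V: "f \<in> L2_space" "g \<in> L2_space" "h \<in> L2_space"
  shows "AE \<xi> in lebesgue. T_converges f g h \<xi>" (is ?conv)
    and "T_op f g h \<in> L2_space" (is ?mem)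
    and "L2_norm (T_op f g h) \<le> 2 * L2_norm f * L2_norm g * L2_norm h" (is ?bound)
proof -
  have m: "f \<in> borel_measurable lebesgue" "g \<in> borel_measurable lebesgue" "h \<in> borel_measurable lebesgue"
    using V by (auto simp: L2_space_def)
  obtain F where F [measurable]: "F \<in> borel_measurable borel" and aF: "AE x in lborel. f x = F x"
    using lebesgue_borel_representative[OF m(1)] by blast
  obtain G where G [measurable]: "G \<in> borel_measurable borel" and aG: "AE x in lborel. g x = G x"
    using lebesgue_borel_representative[OF m(2)] by blast
  obtain H where H [measurable]: "H \<in> borel_measurable borel" and aH: "AE x in lborel. h x = H x"
    using lebesgue_borel_representative[OF m(3)] by blast
  have eq: "T_op f g h = T_op F G H"
    using T_op_AE_cong[OF F G H aF aG aH] by blast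
  note [measurable] = T_majorant_measurable[OF F G H] T_op_measurable[OF F G H]
  let ?B = "2 * L2_norm f * L2_norm g * L2_norm h"
  have B0: "0 \<le> ?B" by (simp add: L2_norm_nonneg)
  have maj: "(\<integral>\<^sup>+\<xi>. (T_majorant F G H \<xi>)\<^sup>2 \<partial>lborel) \<le> ennreal (?B\<^sup>2)"
  proof -
    have "(\<integral>\<^sup>+\<xi>. (T_majorant F G H \<xi>)\<^sup>2 \<partial>lborel) \<le>
      4 * (ennreal ((L2_norm f)\<^sup>2) * ennreal ((L2_norm g)\<^sup>2) * ennreal ((L2_norm h)\<^sup>2))"
      using nn_integral_T_majorant_squared_le[OF F G H]
      by (simp only: nn_integral_square_eq_L2_norm[OF V(1) aF] nn_integral_square_eq_L2_norm[OF V(2) aG]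
          nn_integral_square_eq_L2_norm[OF V(3) aH])
    also have "\<dots> = ennreal (?B\<^sup>2)"
      by (simp add: ennreal_mult' power_mult_distrib mult.assoc)
    finally show ?thesis .
  qed
  have "AE \<xi> in lborel. (T_majorant F G H \<xi>)\<^sup>2 \<noteq> \<infinity>"
    using maj by (intro nn_integral_noteq_infinite) (auto simp: top_unique)
  hence "AE \<xi> in lborel. T_converges F G H \<xi>"
    by eventually_elim (auto simp: T_converges_iff_majorant power_eq_top_ennreal less_top)
  thus ?conv
    by (intro AE_completion) (simp add: T_converges_AE_cong[OF F G H aF aG aH])
  have "(\<integral>\<^sup>+\<xi>. ennreal ((cmod (T_op F G H \<xi>))\<^sup>2) \<partial>lborel) \<le> (\<integral>\<^sup>+\<xi>. (T_majorant F G H \<xi>)\<^sup>2 \<partial>lborel)"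
    by (intro nn_integral_mono) (simp add: ennreal_power[symmetric] power_mono T_op_le_majorant)
  with maj have T: "(\<integral>\<^sup>+\<xi>. ennreal ((cmod (T_op F G H \<xi>))\<^sup>2) \<partial>lborel) \<le> ennreal (?B\<^sup>2)"
    by (rule order_trans[rotated])
  have "integrable lborel (\<lambda>\<xi>. (cmod (T_op F G H \<xi>))\<^sup>2)"
    unfolding integrable_iff_bounded using T by (auto intro: le_less_trans)
  thus mem: ?mem
    by (simp add: L2_space_def eq integrable_completion measurable_completion)
  have "ennreal ((L2_norm (T_op f g h))\<^sup>2) \<le> ennreal (?B\<^sup>2)"
    using T nn_integral_square_eq_L2_norm[OF mem, of "T_op F G H"] by (simp add: eq ennreal_power)
  thus ?bound
    using B0 by (auto simp: L2_norm_nonneg ennreal_le_iff dest: power2_le_imp_le)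
qed

section \<open>An integral with two singularities\<close>

lemma nn_integral_even_le:
  fixes F :: "real \<Rightarrow> ennreal"
  assumes [measurable]: "F \<in> borel_measurable borel"
  shows "(\<integral>\<^sup>+t. F \<bar>t\<bar> \<partial>lborel) \<le> 2 * (\<integral>\<^sup>+t. indicator {0..} t * F t \<partial>lborel)"
proof -
  let ?G = "\<lambda>t. indicator {0..} t * F t"
  have "(\<integral>\<^sup>+t. F \<bar>t\<bar> \<partial>lborel) \<le> (\<integral>\<^sup>+t. ?G t + ?G (0 + (-1) * t) \<partial>lborel)"
    by (intro nn_integral_mono) (auto simp: indicator_def abs_if)
  also have "\<dots> = (\<integral>\<^sup>+t. ?G t \<partial>lborel) + (\<integral>\<^sup>+t. ?G (0 + (-1) * t) \<partial>lborel)"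
    by (rule nn_integral_add) measurable
  also have "(\<integral>\<^sup>+t. ?G (0 + (-1) * t) \<partial>lborel) = (\<integral>\<^sup>+t. ?G t \<partial>lborel)"
    using nn_integral_real_affine[of ?G "-1" 0] by simp
  finally show ?thesis by (simp add: mult_2)
qed

lemma nn_integral_powr_from_0:
  assumes "a > -1" "c \<ge> 0"
  shows "(\<integral>\<^sup>+t. indicator {0..c} t * ennreal (t powr a) \<partial>lborel) = ennreal (c powr (a + 1) / (a + 1))"
proof -
  have "((\<lambda>t. if t \<in> {0..c} then t powr a else 0) has_integral (c powr (a + 1) / (a + 1))) UNIV"
    using has_integral_powr_from_0[OF assms] by (simp only: has_integral_restrict_UNIV)
  hence "(\<integral>\<^sup>+t. ennreal (if t \<in> {0..c} then t powr a else 0) \<partial>lborel) = ennreal (c powr (a + 1) / (a + 1))"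
    by (intro nn_integral_has_integral_lborel) auto
  thus ?thesis by (subst nn_integral_cong[where v = "\<lambda>t. ennreal (if t \<in> {0..c} then t powr a else 0)"]) auto
qed

lemma nn_integral_powr_to_inf:
  fixes a c :: real
  assumes "a < -1" "c > 0"
  shows "(\<integral>\<^sup>+t. indicator {c..} t * ennreal (t powr a) \<partial>lborel) = ennreal (- (c powr (a + 1)) / (a + 1))"
proof -
  have "((\<lambda>t. if t \<in> {c..} then t powr a else 0) has_integral (- (c powr (a + 1)) / (a + 1))) UNIV"
    using has_integral_powr_to_inf[OF assms] by (simp only: has_integral_restrict_UNIV)
  hence "(\<integral>\<^sup>+t. ennreal (if t \<in> {c..} then t powr a else 0) \<partial>lborel) = ennreal (- (c powr (a + 1)) / (a + 1))"
    by (intro nn_integral_has_integral_lborel) auto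
  thus ?thesis by (subst nn_integral_cong[where v = "\<lambda>t. ennreal (if t \<in> {c..} then t powr a else 0)"]) auto
qed

text \<open>
  Of order \<open>t powr (-3/2)\<close> near \<open>0\<close> and \<open>t powr (-5/2)\<close> beyond \<open>r\<close>, so that, evaluated at
  \<open>norm y\<close>, it is integrable over the plane at both ends.
\<close>
definition radial_profile :: "real \<Rightarrow> real \<Rightarrow> real" where
  "radial_profile r t = 1 / (t * sqrt t * max r t)"

lemma radial_profile_measurable [measurable]: "radial_profile r \<in> borel_measurable borel"
  unfolding radial_profile_def[abs_def] by measurable

lemma radial_profile_nonneg: "0 < r \<Longrightarrow> 0 \<le> t \<Longrightarrow> 0 \<le> radial_profile r t"
  by (simp add: radial_profile_def)

lemma radial_profile_antimono: "0 < r \<Longrightarrow> 0 < s \<Longrightarrow> s \<le> t \<Longrightarrow> radial_profile r t \<le> radial_profile r s"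
  unfolding radial_profile_def by (intro divide_left_mono mult_mono max.mono mult_pos_pos) auto

lemma nn_integral_sqrt_radial_profile:
  assumes r: "0 < r"
  shows "(\<integral>\<^sup>+t. ennreal (sqrt (radial_profile r \<bar>t\<bar>)) \<partial>lborel) \<le> ennreal (16 / sqrt (sqrt r))"
proof -
  have *: "sqrt (radial_profile r t) = t powr (-3/4) / sqrt (max r t)" if "t \<ge> 0" for t
  proof (cases "t = 0")
    case False
    hence t: "t > 0" using that by simp
    have "t * sqrt t = t powr (3/2)"
      using t by (simp add: powr_half_sqrt[symmetric] powr_mult_base)
    hence "radial_profile r t = t powr (-3/2) / max r t"
      unfolding radial_profile_def by (simp add: powr_minus_divide)
    hence "sqrt (radial_profile r t) = sqrt (t powr (-3/2)) / sqrt (max r t)"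
      by (simp add: real_sqrt_divide)
    also have "sqrt (t powr (-3/2)) = t powr (-3/4)"
      using t by (simp add: powr_half_sqrt[symmetric] powr_powr)
    finally show ?thesis .
  qed (simp add: radial_profile_def)
  let ?s = "ennreal (1 / sqrt r)"
  have le: "indicator {0..} t * ennreal (sqrt (radial_profile r t)) \<le>
      ?s * (indicator {0..r} t * ennreal (t powr (-3/4))) + indicator {r..} t * ennreal (t powr (-5/4))" for t
  proof -
    consider "t < 0" | "0 \<le> t" "t \<le> r" | "r < t" using r by linarith
    thus ?thesis
    proof cases
      case 2
      hence "sqrt (radial_profile r t) = 1 / sqrt r * t powr (-3/4)" by (simp add: * max_def)
      thus ?thesis using 2 r by (simp add: ennreal_mult' [symmetric] del: ennreal_mult')
    next
      case 3
      have "sqrt (radial_profile r t) = t powr (-3/4) / t powr (1/2)" using 3 r by (simp add: * max_def powr_half_sqrt)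
      also have "\<dots> = t powr (-5/4)" using 3 r by (simp flip: powr_diff)
      finally show ?thesis using 3 r by simp
    qed simp
  qed
  have "(\<integral>\<^sup>+t. ennreal (sqrt (radial_profile r \<bar>t\<bar>)) \<partial>lborel) \<le> 2 * (\<integral>\<^sup>+t. indicator {0..} t * ennreal (sqrt (radial_profile r t)) \<partial>lborel)"
    by (rule nn_integral_even_le) measurable
  also have "\<dots> \<le> 2 * (\<integral>\<^sup>+t. ?s * (indicator {0..r} t * ennreal (t powr (-3/4)))
      + indicator {r..} t * ennreal (t powr (-5/4)) \<partial>lborel)"
    by (intro mult_left_mono nn_integral_mono le) auto
  also have "(\<integral>\<^sup>+t. ?s * (indicator {0..r} t * ennreal (t powr (-3/4)))
      + indicator {r..} t * ennreal (t powr (-5/4)) \<partial>lborel)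
      = ?s * ennreal (r powr (-3/4 + 1) / (-3/4 + 1)) + ennreal (- (r powr (-5/4 + 1)) / (-5/4 + 1))"
    using r by (simp only: nn_integral_powr_from_0[of "-3/4" r, symmetric] nn_integral_powr_to_inf[of "-5/4" r, symmetric])
      (subst nn_integral_add, simp_all add: nn_integral_cmult)
  also have "\<dots> = ennreal (8 / sqrt (sqrt r))"
  proof -
    have 1: "sqrt (sqrt r) = r powr (1/4)"
      using r by (simp add: powr_half_sqrt[symmetric] powr_powr)
    have 2: "r powr (1/4) / sqrt r = 1 / r powr (1/4)"
      using r by (simp add: powr_half_sqrt[symmetric] field_simps flip: powr_add)
    have "?s * ennreal (r powr (-3/4 + 1) / (-3/4 + 1)) = ennreal (4 * (r powr (1/4) / sqrt r))"
      using r by (simp add: ennreal_mult'[symmetric] del: ennreal_mult')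
    moreover have "- (r powr (-5/4 + 1)) / (-5/4 + 1) = 4 * (1 / r powr (1/4))"
      by (simp add: powr_minus_divide)
    ultimately show ?thesis
      unfolding 1 2 by (simp flip: ennreal_plus)
  qed
  also have "2 * ennreal (8 / sqrt (sqrt r)) = ennreal (16 / sqrt (sqrt r))"
    using r by (subst ennreal_numeral[symmetric], subst ennreal_mult[symmetric]) auto
  finally show ?thesis .
qed

text \<open>
  Polar coordinates are avoided. The profile is decreasing and \<open>\<bar>y\<bar>\<close> dominates both
  coordinates, so its value is at most the product of the square roots of its values at the two
  coordinates, and the integral factorises.
\<close>
lemma nn_integral_radial_profile:
  assumes r: "0 < r"
  shows "(\<integral>\<^sup>+y. ennreal (radial_profile r (norm (y :: real ^ 2))) \<partial>lborel) \<le> ennreal (256 / sqrt r)"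
proof -
  let ?u = "\<lambda>t. ennreal (sqrt (radial_profile r \<bar>t\<bar>))"
  have B: "(Basis :: (real ^ 2) set) = {axis 1 1, axis 2 1}" 
    by (auto simp: Basis_vec_def UNIV_2)
  have ne: "axis 1 1 \<noteq> (axis 2 1 :: real ^ 2)" by (simp add: axis_eq_axis)
  have prod: "(\<Prod>b\<in>Basis. ?u (y \<bullet> b)) = ?u (y $ 1) * ?u (y $ 2)" for y :: "real ^ 2"
    using ne by (simp add: B inner_axis)
  have "AE y in lebesgue. (y :: real ^ 2) $ i \<noteq> 0" for i :: 2
    using AE_not_in[of "{x. x $ i = 0}" lebesgue] negligible_standard_hyperplane_cart[of i]
    by (simp add: negligible_iff_null_sets)
  hence "AE y in lborel. (y :: real ^ 2) $ i \<noteq> 0" for i :: 2 by (simp add: AE_completion_iff)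
  \<comment> \<open>Off the axes both coordinates lie where the profile is decreasing; at \<open>0\<close> it takes the value \<open>1 / 0 = 0\<close>.\<close>
  from this[of 1] this[of 2]
  have "AE y in lborel. ennreal (radial_profile r (norm (y :: real ^ 2))) \<le> ?u (y $ 1) * ?u (y $ 2)"
  proof eventually_elim
    case (elim y)
    have "radial_profile r (norm y) = sqrt (radial_profile r (norm y)) * sqrt (radial_profile r (norm y))"
      using r by (simp add: radial_profile_nonneg)
    also have "\<dots> \<le> sqrt (radial_profile r \<bar>y $ 1\<bar>) * sqrt (radial_profile r \<bar>y $ 2\<bar>)"
      using elim r component_le_norm_cart[of y]
      by (intro mult_mono real_sqrt_le_mono radial_profile_antimono) (auto simp: radial_profile_nonneg)
    finally show ?case using r by (simp add: radial_profile_nonneg flip: ennreal_mult)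
  qed
  hence "(\<integral>\<^sup>+y. ennreal (radial_profile r (norm (y :: real ^ 2))) \<partial>lborel) \<le> (\<integral>\<^sup>+y. (\<Prod>b\<in>Basis. ?u ((y :: real ^ 2) \<bullet> b)) \<partial>lborel)"
    unfolding prod by (rule nn_integral_mono_AE)
  also have "\<dots> = (\<integral>\<^sup>+t. ?u t \<partial>lborel) * (\<integral>\<^sup>+t. ?u t \<partial>lborel)"
    using ne by (subst nn_integral_lborel_prod) (auto simp: B)
  also have "\<dots> \<le> ennreal (16 / sqrt (sqrt r)) * ennreal (16 / sqrt (sqrt r))"
    by (intro mult_mono nn_integral_sqrt_radial_profile r) auto
  also have "\<dots> = ennreal (256 / sqrt r)"
    using r by (simp flip: ennreal_mult)
  finally show ?thesis .
qed

text \<open>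
  Of two radii with sum at least \<open>n\<close> the larger is at least \<open>n / 2\<close>. Half a power of it is given
  up for the factor \<open>sqrt (2 / n)\<close>, and the other half is estimated by the smaller radius, which
  leaves three halves of a power of the smaller one.
\<close>
lemma inverse_product_le_radial_profile:
  assumes "0 \<le> p" "0 \<le> q" and n: "0 < n" "n \<le> p + q" and r: "0 < r"
  shows "1 / (p * q * max r p) \<le> sqrt (2 / n) * (radial_profile r p + radial_profile r q)"
\<comment> \<open>If a radius vanishes, the left-hand side is \<open>1 / 0 = 0\<close>.\<close>
proof (cases "p = 0 \<or> q = 0")
  case False
  hence pos: "0 < p" "0 < q" using assms by auto
  have key: "1 / (m * M) \<le> sqrt (2 / n) * (1 / (m * sqrt m))" if "0 < m" "m \<le> M" "n \<le> m + M" for m M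
  proof -
    have M: "0 < M" using that by simp
    have "1 = sqrt (2 / n) * sqrt (n / 2)" using n by (simp flip: real_sqrt_mult)
    also have "\<dots> \<le> sqrt (2 / n) * sqrt M" using that n by (intro mult_left_mono) auto
    finally have "1 / (m * M) \<le> sqrt (2 / n) * sqrt M / (m * M)"
      using that M by (intro divide_right_mono) auto
    also have "\<dots> = sqrt (2 / n) * (1 / (m * sqrt M))"
      using that M by (simp add: field_simps)
    also have "\<dots> \<le> sqrt (2 / n) * (1 / (m * sqrt m))"
      using that n by (intro mult_left_mono divide_left_mono mult_pos_pos) auto
    finally show ?thesis .
  qed
  have nn: "0 \<le> radial_profile r p" "0 \<le> radial_profile r q" using pos r by (auto simp: radial_profile_nonneg)
  show ?thesis
  proof (cases "p \<le> q")
    case True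
    have "1 / (p * q * max r p) = 1 / (p * q) * (1 / max r p)" by simp
    also have "\<dots> \<le> sqrt (2 / n) * (1 / (p * sqrt p)) * (1 / max r p)"
      using key[of p q] pos True n r by (intro mult_right_mono) auto
    also have "\<dots> = sqrt (2 / n) * radial_profile r p" by (simp add: radial_profile_def)
    also have "\<dots> \<le> sqrt (2 / n) * (radial_profile r p + radial_profile r q)"
      using n nn by (intro mult_left_mono) auto
    finally show ?thesis .
  next
    case False
    have "1 / (p * q * max r p) = 1 / (q * p) * (1 / max r p)" by (simp add: mult.commute)
    also have "\<dots> \<le> sqrt (2 / n) * (1 / (q * sqrt q)) * (1 / max r q)"
      using key[of q p] pos False n r by (intro mult_mono divide_left_mono) (auto simp: max_def)
    also have "\<dots> = sqrt (2 / n) * radial_profile r q" by (simp add: radial_profile_def)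
    also have "\<dots> \<le> sqrt (2 / n) * (radial_profile r p + radial_profile r q)"
      using n nn by (intro mult_left_mono) auto
    finally show ?thesis .
  qed
qed (use assms in \<open>auto simp: radial_profile_nonneg intro!: mult_nonneg_nonneg\<close>)

text \<open>
  The pointwise bound by two radial profiles, one centred at each singularity, gives two
  translates of the same integral.
\<close>
lemma nn_integral_two_singularities:
  fixes v :: "real ^ 2"
  assumes v: "v \<noteq> 0" and r: "0 < r"
  shows "(\<integral>\<^sup>+y. ennreal (1 / (norm y * norm (y + v) * max r (norm y))) \<partial>lborel)
    \<le> ennreal (512 * sqrt (2 / (norm v * r)))"
proof -
  let ?I = "\<integral>\<^sup>+y. ennreal (radial_profile r (norm (y :: real ^ 2))) \<partial>lborel"
  have pt: "1 / (norm y * norm (y + v) * max r (norm y))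
      \<le> sqrt (2 / norm v) * (radial_profile r (norm y) + radial_profile r (norm (v + 1 *\<^sub>R y + 0 *\<^sub>R perp y)))" for y
    using inverse_product_le_radial_profile[of "norm y" "norm (y + v)" "norm v" r] v r
      norm_triangle_ineq4[of "y + v" y] by (simp add: add.commute)
  have "(\<integral>\<^sup>+y. ennreal (1 / (norm y * norm (y + v) * max r (norm y))) \<partial>lborel) \<le>
    (\<integral>\<^sup>+y. ennreal (sqrt (2 / norm v)) * (ennreal (radial_profile r (norm y))
       + ennreal (radial_profile r (norm (v + 1 *\<^sub>R y + 0 *\<^sub>R perp y)))) \<partial>lborel)"
    using pt r by (intro nn_integral_mono) (simp add: radial_profile_nonneg ennreal_leI flip: ennreal_mult ennreal_plus)
  also have "\<dots> = ennreal (sqrt (2 / norm v)) * (?I + (\<integral>\<^sup>+y. ennreal (radial_profile r (norm (v + 1 *\<^sub>R y + 0 *\<^sub>R perp y))) \<partial>lborel))"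
    by (subst nn_integral_cmult, measurable, subst nn_integral_add, measurable)
  also have "(\<integral>\<^sup>+y. ennreal (radial_profile r (norm (v + 1 *\<^sub>R y + 0 *\<^sub>R perp y))) \<partial>lborel) = ?I"
    using nn_integral_lborel_similarity[of "\<lambda>y. ennreal (radial_profile r (norm y))" 1 0 v]
    by (simp add: divide_ennreal_def)
  also have "ennreal (sqrt (2 / norm v)) * (?I + ?I) \<le>
      ennreal (sqrt (2 / norm v)) * (ennreal (256 / sqrt r) + ennreal (256 / sqrt r))"
    by (intro mult_left_mono add_mono nn_integral_radial_profile r) auto
  also have "\<dots> = ennreal (512 * sqrt (2 / (norm v * r)))"
    using r by (simp add: real_sqrt_divide real_sqrt_mult flip: ennreal_mult ennreal_plus)
  finally show ?thesis .
qed

section \<open>The weighted case\<close>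

lemma British_flag:
  "(norm (\<xi> + x))\<^sup>2 + (norm (\<xi> + l *\<^sub>R perp x))\<^sup>2 = (norm (\<xi> + x + l *\<^sub>R perp x))\<^sup>2 + (norm \<xi>)\<^sup>2"
  by (simp add: power2_norm_eq_inner inner_add_left inner_add_right inner_commute)

text \<open>
  Since \<open>a + b \<ge> sqrt (a\<^sup>2 + b\<^sup>2) \<ge> max n c\<close>, the identity
  \<open>1 / (a b) = (1 / a + 1 / b) / (a + b)\<close> trades one of the factors \<open>a\<close>, \<open>b\<close> for \<open>max n c\<close>.
\<close>
lemma rectangle_kernel_split:
  fixes a b c n :: real
  assumes pos: "0 < n" "0 \<le> a" "0 \<le> b" "0 \<le> c" and flag: "a\<^sup>2 + b\<^sup>2 = c\<^sup>2 + n\<^sup>2"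
  shows "1 / (a * c * b) \<le> 1 / (c * a * max n c) + 1 / (c * b * max n c)"
\<comment> \<open>If a norm vanishes, the left-hand side is \<open>1 / 0 = 0\<close>.\<close>
proof (cases "a = 0 \<or> b = 0 \<or> c = 0")
  case False
  hence p: "0 < a" "0 < b" "0 < c"
    using pos by auto
  have "n\<^sup>2 \<le> (a + b)\<^sup>2" "c\<^sup>2 \<le> (a + b)\<^sup>2"
  proof -
    have "c\<^sup>2 + n\<^sup>2 \<le> (a + b)\<^sup>2"
      using flag p by (simp add: power2_sum)
    thus "n\<^sup>2 \<le> (a + b)\<^sup>2" "c\<^sup>2 \<le> (a + b)\<^sup>2"
      by (smt (verit) zero_le_power2)+
  qed
  hence "n \<le> a + b" "c \<le> a + b" using p by (auto intro: power2_le_imp_le)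
  hence m: "max n c \<le> a + b" by simp
  have "1 / (a * c * b) = 1 / (a * b * c * max n c) * max n c" using pos p by simp
  also have "\<dots> \<le> 1 / (a * b * c * max n c) * (a + b)"
    using m pos p by (intro mult_left_mono) auto
  also have "\<dots> = 1 / (c * a * max n c) + 1 / (c * b * max n c)"
    using pos p by (simp add: divide_simps)
  finally show ?thesis .
qed (use pos in auto)

text \<open>
  Put \<open>y = \<xi> + x + l J x\<close>. Applying \<open>1 + l J\<close> to the other two vertices \<open>\<xi> + x\<close> and \<open>\<xi> + l J x\<close>
  gives \<open>y + l J \<xi>\<close> and \<open>\<xi> + l J y = l J (y - J \<xi> / l)\<close>, so both terms of the split kernel are
  functions of \<open>y\<close> with a second singularity at \<open>-v1\<close> or \<open>-v2\<close>. The second carries the extra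
  factor \<open>1 / \<bar>l\<bar>\<close>, but its singularities are at distance \<open>\<bar>\<xi>\<bar> / \<bar>l\<bar>\<close> instead of \<open>\<bar>l\<bar> \<bar>\<xi>\<bar>\<close>, which
  makes up for it exactly.
\<close>
lemma nn_integral_rectangle_kernel:
  fixes \<xi> :: "real ^ 2"
  assumes \<xi>: "\<xi> \<noteq> 0" and l: "l \<noteq> 0"
  shows "(\<integral>\<^sup>+x. ennreal (1 / (norm (\<xi> + x) * norm (\<xi> + x + l *\<^sub>R perp x) * norm (\<xi> + l *\<^sub>R perp x))) \<partial>lborel)
    \<le> ennreal (2048 / (sqrt \<bar>l\<bar> * norm \<xi>))"
proof -
  let ?n = "norm \<xi>" and ?s = "sqrt (1 + l\<^sup>2)"
  have n: "0 < ?n" using \<xi> by simp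
  have s: "0 < ?s" by (simp add: add_pos_nonneg)
  define \<phi> where "\<phi> = (\<lambda>(v :: real ^ 2) y. 1 / (norm y * norm (y + v) * max ?n (norm y)) :: real)"
  have \<phi>_nn: "0 \<le> \<phi> v y" for v y
    unfolding \<phi>_def by (intro divide_nonneg_nonneg mult_nonneg_nonneg) (auto simp: le_max_iff_disj)
  have [measurable]: "\<phi> v \<in> borel_measurable borel" for v unfolding \<phi>_def by measurable
  define v1 v2 where "v1 = l *\<^sub>R perp \<xi>" and "v2 = (- 1 / l) *\<^sub>R perp \<xi>"
  have nv: "norm v1 = \<bar>l\<bar> * ?n" "norm v2 = ?n / \<bar>l\<bar>" by (simp_all add: v1_def v2_def)
  have pt: "1 / (norm (\<xi> + x) * norm (\<xi> + x + l *\<^sub>R perp x) * norm (\<xi> + l *\<^sub>R perp x))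
    \<le> ?s * (\<phi> v1 (\<xi> + x + l *\<^sub>R perp x) + 1 / \<bar>l\<bar> * \<phi> v2 (\<xi> + x + l *\<^sub>R perp x))" for x
  proof -
    define y where "y = \<xi> + x + l *\<^sub>R perp x"
    have "(\<xi> + x) + l *\<^sub>R perp (\<xi> + x) = y + v1"
      by (simp add: y_def v1_def perp_add algebra_simps)
    hence a: "norm (y + v1) = ?s * norm (\<xi> + x)" using norm_similarity by metis
    have "(\<xi> + l *\<^sub>R perp x) + l *\<^sub>R perp (\<xi> + l *\<^sub>R perp x) = l *\<^sub>R perp (y + v2)"
      using l by (simp add: y_def v2_def perp_add perp_diff perp_scaleR algebra_simps)
    hence b: "\<bar>l\<bar> * norm (y + v2) = ?s * norm (\<xi> + l *\<^sub>R perp x)"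
      using norm_similarity[of "\<xi> + l *\<^sub>R perp x" l] by simp
    have "1 / (norm (\<xi> + x) * norm y * norm (\<xi> + l *\<^sub>R perp x)) \<le>
       1 / (norm y * norm (\<xi> + x) * max ?n (norm y)) + 1 / (norm y * norm (\<xi> + l *\<^sub>R perp x) * max ?n (norm y))"
      using British_flag[of \<xi> x l] n by (intro rectangle_kernel_split) (auto simp: y_def)
    also have "1 / (norm y * norm (\<xi> + x) * max ?n (norm y)) = ?s * \<phi> v1 y"
      using s by (simp add: \<phi>_def a)
    also have "1 / (norm y * norm (\<xi> + l *\<^sub>R perp x) * max ?n (norm y)) = ?s * (1 / \<bar>l\<bar> * \<phi> v2 y)"
    proof -
      have "norm (\<xi> + l *\<^sub>R perp x) = \<bar>l\<bar> * norm (y + v2) / ?s" using b s by simp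
      thus ?thesis by (simp add: \<phi>_def)
    qed
    finally show ?thesis by (simp add: y_def distrib_left)
  qed
  have int: "(\<integral>\<^sup>+x. ennreal (?s * \<phi> v (\<xi> + x + l *\<^sub>R perp x)) \<partial>lborel) \<le> (\<integral>\<^sup>+y. ennreal (\<phi> v y) \<partial>lborel)" for v
  proof -
    have "(\<integral>\<^sup>+x. ennreal (?s * \<phi> v (\<xi> + x + l *\<^sub>R perp x)) \<partial>lborel)
      = ennreal ?s * (\<integral>\<^sup>+x. ennreal (\<phi> v (\<xi> + x + l *\<^sub>R perp x)) \<partial>lborel)"
      using s by (simp add: ennreal_mult \<phi>_nn nn_integral_cmult)
    also have "\<dots> \<le> ennreal (1 + l\<^sup>2) * ((\<integral>\<^sup>+y. ennreal (\<phi> v y) \<partial>lborel) / ennreal (1 + l\<^sup>2))"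
    proof (rule mult_mono)
      \<comment> \<open>The Jacobian \<open>1 + l\<^sup>2\<close> absorbs the scaling factor \<open>sqrt (1 + l\<^sup>2)\<close> of the norms.\<close>
      have "?s \<le> ?s * ?s" using mult_left_mono[of 1 ?s ?s] s by simp
      thus "ennreal ?s \<le> ennreal (1 + l\<^sup>2)" by (intro ennreal_leI) simp
      show "(\<integral>\<^sup>+x. ennreal (\<phi> v (\<xi> + x + l *\<^sub>R perp x)) \<partial>lborel) \<le> (\<integral>\<^sup>+y. ennreal (\<phi> v y) \<partial>lborel) / ennreal (1 + l\<^sup>2)"
        using nn_integral_lborel_similarity[of "\<lambda>y. ennreal (\<phi> v y)" 1 l \<xi>] by simp
    qed auto
    also have "\<dots> = (\<integral>\<^sup>+y. ennreal (\<phi> v y) \<partial>lborel) * ennreal (1 + l\<^sup>2) / ennreal (1 + l\<^sup>2)"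
      by (simp only: ennreal_times_divide mult.commute)
    also have "\<dots> = (\<integral>\<^sup>+y. ennreal (\<phi> v y) \<partial>lborel)"
      by (rule mult_divide_eq_ennreal) (simp_all add: ennreal_eq_0_iff add_nonneg_eq_0_iff not_le add_pos_nonneg del: ennreal_plus)
    finally show ?thesis .
  qed
  have sing: "(\<integral>\<^sup>+y. ennreal (\<phi> v y) \<partial>lborel) \<le> ennreal (512 * sqrt (2 / (norm v * ?n)))" if "v \<noteq> 0" for v
    unfolding \<phi>_def by (rule nn_integral_two_singularities[OF that n])
  have v0: "v1 \<noteq> 0" "v2 \<noteq> 0" using nv l n by auto
  have "(\<integral>\<^sup>+x. ennreal (1 / (norm (\<xi> + x) * norm (\<xi> + x + l *\<^sub>R perp x) * norm (\<xi> + l *\<^sub>R perp x))) \<partial>lborel)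
    \<le> (\<integral>\<^sup>+x. ennreal (?s * \<phi> v1 (\<xi> + x + l *\<^sub>R perp x))
      + ennreal (1 / \<bar>l\<bar>) * ennreal (?s * \<phi> v2 (\<xi> + x + l *\<^sub>R perp x)) \<partial>lborel)"
  proof (rule nn_integral_mono)
    fix x
    have "ennreal (?s * \<phi> v1 (\<xi> + x + l *\<^sub>R perp x)) + ennreal (1 / \<bar>l\<bar>) * ennreal (?s * \<phi> v2 (\<xi> + x + l *\<^sub>R perp x))
       = ennreal (?s * (\<phi> v1 (\<xi> + x + l *\<^sub>R perp x) + 1 / \<bar>l\<bar> * \<phi> v2 (\<xi> + x + l *\<^sub>R perp x)))"
      using s \<phi>_nn by (simp add: distrib_left mult.left_commute flip: ennreal_mult ennreal_plus)
    thus "ennreal (1 / (norm (\<xi> + x) * norm (\<xi> + x + l *\<^sub>R perp x) * norm (\<xi> + l *\<^sub>R perp x)))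
      \<le> ennreal (?s * \<phi> v1 (\<xi> + x + l *\<^sub>R perp x)) + ennreal (1 / \<bar>l\<bar>) * ennreal (?s * \<phi> v2 (\<xi> + x + l *\<^sub>R perp x))"
      using pt[of x] by (simp only: ennreal_leI)
  qed
  also have "\<dots> = (\<integral>\<^sup>+x. ennreal (?s * \<phi> v1 (\<xi> + x + l *\<^sub>R perp x)) \<partial>lborel)
      + ennreal (1 / \<bar>l\<bar>) * (\<integral>\<^sup>+x. ennreal (?s * \<phi> v2 (\<xi> + x + l *\<^sub>R perp x)) \<partial>lborel)"
    by (subst nn_integral_add, measurable, subst nn_integral_cmult, measurable)
  also have "\<dots> \<le> ennreal (512 * sqrt (2 / (norm v1 * ?n))) + ennreal (1 / \<bar>l\<bar>) * ennreal (512 * sqrt (2 / (norm v2 * ?n)))"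
    by (intro add_mono mult_left_mono order_trans[OF int sing] v0) auto
  also have "\<dots> = ennreal (512 * sqrt (2 / (norm v1 * ?n)) + 1 / \<bar>l\<bar> * (512 * sqrt (2 / (norm v2 * ?n))))"
    by (simp flip: ennreal_mult ennreal_plus)
  also have "\<dots> \<le> ennreal (2048 / (sqrt \<bar>l\<bar> * ?n))"
  proof (rule ennreal_leI)
    have 1: "sqrt (2 / (norm v1 * ?n)) = sqrt 2 / (sqrt \<bar>l\<bar> * ?n)"
      using n by (simp add: nv real_sqrt_divide real_sqrt_mult mult.assoc)
    have "1 / \<bar>l\<bar> * sqrt (2 / (norm v2 * ?n)) = sqrt 2 * (sqrt \<bar>l\<bar> / \<bar>l\<bar>) / ?n"
      using n by (simp add: nv real_sqrt_divide real_sqrt_mult)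
    hence 2: "1 / \<bar>l\<bar> * sqrt (2 / (norm v2 * ?n)) = sqrt 2 / (sqrt \<bar>l\<bar> * ?n)"
      by (simp add: sqrt_divide_self_eq divide_simps)
    have "512 * sqrt (2 / (norm v1 * ?n)) + 1 / \<bar>l\<bar> * (512 * sqrt (2 / (norm v2 * ?n)))
      = 1024 * sqrt 2 / (sqrt \<bar>l\<bar> * ?n)" using 1 2 by simp
    also have "\<dots> \<le> 2048 / (sqrt \<bar>l\<bar> * ?n)"
      using n real_sqrt_le_mono[of 2 4] by (intro divide_right_mono) auto
    finally show "512 * sqrt (2 / (norm v1 * ?n)) + 1 / \<bar>l\<bar> * (512 * sqrt (2 / (norm v2 * ?n))) \<le> 2048 / (sqrt \<bar>l\<bar> * ?n)" .
  qed
  finally show ?thesis .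
qed

text \<open>
  The factor \<open>1 / sqrt \<bar>l\<bar>\<close> has integral \<open>4\<close> over \<open>[-1, 1]\<close>, whence \<open>8192 = 4 * 2048\<close>.
\<close>
lemma T_majorant_le_of_decay:
  assumes [measurable]: "f \<in> borel_measurable borel" "g \<in> borel_measurable borel" "h \<in> borel_measurable borel"
    and nn: "0 \<le> A" "0 \<le> B" "0 \<le> C"
    and f: "\<And>x. cmod (f x) \<le> A / norm x" and g: "\<And>x. cmod (g x) \<le> B / norm x" and h: "\<And>x. cmod (h x) \<le> C / norm x"
    and \<xi>: "\<xi> \<noteq> 0"
  shows "T_majorant f g h \<xi> \<le> ennreal (8192 * A * B * C / norm \<xi>)"
proof -
  let ?K = "\<lambda>l x. 1 / (norm (\<xi> + x) * norm (\<xi> + x + l *\<^sub>R perp x) * norm (\<xi> + l *\<^sub>R perp x))"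
  let ?c = "A * B * C * (2048 / norm \<xi>)"
  have c: "0 \<le> ?c" using nn by simp
  have inner: "(\<integral>\<^sup>+x. ennreal (cmod (T_integrand f g h \<xi> l x)) \<partial>lborel) \<le> ennreal ?c * ennreal (\<bar>l\<bar> powr (-1/2))"
    if l: "l \<noteq> 0" for l
  proof -
    have "(\<integral>\<^sup>+x. ennreal (cmod (T_integrand f g h \<xi> l x)) \<partial>lborel)
        \<le> (\<integral>\<^sup>+x. ennreal (A * B * C) * ennreal (?K l x) \<partial>lborel)"
    proof (rule nn_integral_mono)
      fix x
      have "cmod (T_integrand f g h \<xi> l x) \<le>
        A / norm (\<xi> + x) * (B / norm (\<xi> + x + l *\<^sub>R perp x)) * (C / norm (\<xi> + l *\<^sub>R perp x))"
        unfolding T_integrand_def norm_mult complex_mod_cnj using nn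
        by (intro mult_mono f g h mult_nonneg_nonneg) auto
      also have "\<dots> = A * B * C * ?K l x" by simp
      finally show "ennreal (cmod (T_integrand f g h \<xi> l x)) \<le> ennreal (A * B * C) * ennreal (?K l x)"
        using nn by (simp add: ennreal_leI flip: ennreal_mult)
    qed
    also have "\<dots> = ennreal (A * B * C) * (\<integral>\<^sup>+x. ennreal (?K l x) \<partial>lborel)"
      by (rule nn_integral_cmult) measurable
    also have "\<dots> \<le> ennreal (A * B * C) * ennreal (2048 / (sqrt \<bar>l\<bar> * norm \<xi>))"
      by (intro mult_left_mono nn_integral_rectangle_kernel \<xi> l) auto
    also have "\<dots> = ennreal ?c * ennreal (\<bar>l\<bar> powr (-1/2))"
    proof -
      have "A * B * C * (2048 / (sqrt \<bar>l\<bar> * norm \<xi>)) = ?c * \<bar>l\<bar> powr (-1/2)"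
        using l by (simp add: powr_minus_divide powr_half_sqrt)
      thus ?thesis using nn by (simp flip: ennreal_mult)
    qed
    finally show ?thesis .
  qed
  have "T_majorant f g h \<xi> \<le> (\<integral>\<^sup>+l. ennreal ?c * (indicator {0..1} \<bar>l\<bar> * ennreal (\<bar>l\<bar> powr (-1/2))) \<partial>lborel)"
    unfolding T_majorant_def
  proof (rule nn_integral_mono_AE)
    show "AE l in lborel. indicator {- 1..1} l * (\<integral>\<^sup>+x. ennreal (cmod (T_integrand f g h \<xi> l x)) \<partial>lborel)
      \<le> ennreal ?c * (indicator {0..1} \<bar>l\<bar> * ennreal (\<bar>l\<bar> powr (-1/2)))"
      using AE_lborel_singleton[of "0::real"]
      by eventually_elim (use inner in \<open>auto simp: indicator_def abs_le_iff\<close>)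
  qed
  also have "\<dots> = ennreal ?c * (\<integral>\<^sup>+l. indicator {0..1} \<bar>l\<bar> * ennreal (\<bar>l\<bar> powr (-1/2)) \<partial>lborel)"
    by (rule nn_integral_cmult) measurable
  also have "\<dots> \<le> ennreal ?c * (2 * (\<integral>\<^sup>+l. indicator {0..} l * (indicator {0..1} l * ennreal (l powr (-1/2))) \<partial>lborel))"
    by (intro mult_left_mono nn_integral_even_le) auto
  also have "(\<integral>\<^sup>+l. indicator {0..} l * (indicator {0..1::real} l * ennreal (l powr (-1/2))) \<partial>lborel)
     = (\<integral>\<^sup>+l. indicator {0..1} l * ennreal (l powr (-1/2)) \<partial>lborel)"
    by (intro nn_integral_cong) (auto simp: indicator_def)
  also have "\<dots> = ennreal 2"
    by (subst nn_integral_powr_from_0) auto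
  also have "ennreal ?c * (2 * ennreal 2) = ennreal (8192 * A * B * C / norm \<xi>)"
    using c by (simp add: mult_ac flip: ennreal_mult ennreal_numeral)
  finally show ?thesis .
qed

lemma X1_enorm_nonneg:
  assumes "f \<in> borel_measurable lebesgue"
  shows "0 \<le> X1_enorm f"
proof -
  have "0 = esssup lebesgue (\<lambda>_::real ^ 2. 0 :: ereal)" by (simp add: esssup_const)
  also have "\<dots> \<le> X1_enorm f" unfolding X1_enorm_def by (intro esssup_mono) auto
  finally show ?thesis .
qed

text \<open>
  A representative for which the decay bound holds at every point. At the origin the bound
  reads \<open>X1_norm f / 0 = 0\<close>, which is why the representative vanishes there.
\<close>
lemma X1_space_decay:
  assumes f: "f \<in> X1_space"
  shows "0 \<le> X1_norm f"
    and "\<exists>f'\<in>borel_measurable borel. (AE x in lborel. f x = f' x) \<and> (\<forall>x. cmod (f' x) \<le> X1_norm f / norm x)"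
proof -
  have m: "f \<in> borel_measurable lebesgue" and fin: "X1_enorm f < \<infinity>" using f by (auto simp: X1_space_def)
  have e: "X1_enorm f = ereal (X1_norm f)"
    using X1_enorm_nonneg[OF m] fin by (cases "X1_enorm f") (auto simp: X1_norm_def)
  show "0 \<le> X1_norm f" using X1_enorm_nonneg[OF m] e by simp
  obtain F where F [measurable]: "F \<in> borel_measurable borel" and aF: "AE x in lborel. f x = F x"
    using lebesgue_borel_representative[OF m] by blast
  have "AE x in lebesgue. ereal (norm x * cmod (f x)) \<le> X1_enorm f"
    unfolding X1_enorm_def by (rule esssup_AE)
  hence bd: "AE x in lborel. norm x * cmod (f x) \<le> X1_norm f"
    by (simp add: e AE_completion_iff)
  let ?F = "\<lambda>x. if x \<noteq> 0 \<and> norm x * cmod (F x) \<le> X1_norm f then F x else 0"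
  show "\<exists>f'\<in>borel_measurable borel. (AE x in lborel. f x = f' x) \<and> (\<forall>x. cmod (f' x) \<le> X1_norm f / norm x)"
  proof (intro bexI[of _ ?F] conjI allI)
    show "AE x in lborel. f x = ?F x"
      using aF bd AE_lborel_singleton[of "0 :: real ^ 2"] by eventually_elim auto
    show "cmod (?F x) \<le> X1_norm f / norm x" for x
      using \<open>0 \<le> X1_norm f\<close> by (auto simp: field_simps)
  qed measurable
qed

lemma X1_estimate:
  assumes V: "f \<in> X1_space" "g \<in> X1_space" "h \<in> X1_space"
  shows "AE \<xi> in lebesgue. T_converges f g h \<xi>" (is ?conv)
    and "T_op f g h \<in> X1_space" (is ?mem)
    and "X1_norm (T_op f g h) \<le> 8192 * X1_norm f * X1_norm g * X1_norm h" (is ?bound)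
proof -
  obtain F where F: "F \<in> borel_measurable borel" and aF: "AE x in lborel. f x = F x"
    and dF: "\<And>x. cmod (F x) \<le> X1_norm f / norm x" using X1_space_decay(2)[OF V(1)] by blast
  obtain G where G: "G \<in> borel_measurable borel" and aG: "AE x in lborel. g x = G x"
    and dG: "\<And>x. cmod (G x) \<le> X1_norm g / norm x" using X1_space_decay(2)[OF V(2)] by blast
  obtain H where H: "H \<in> borel_measurable borel" and aH: "AE x in lborel. h x = H x"
    and dH: "\<And>x. cmod (H x) \<le> X1_norm h / norm x" using X1_space_decay(2)[OF V(3)] by blast
  let ?B = "8192 * X1_norm f * X1_norm g * X1_norm h"
  have maj: "T_majorant F G H \<xi> \<le> ennreal (?B / norm \<xi>)" if "\<xi> \<noteq> 0" for \<xi>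
    by (rule T_majorant_le_of_decay[OF F G H _ _ _ dF dG dH that]) (use V in \<open>auto intro: X1_space_decay\<close>)
  have B0: "0 \<le> ?B" using V by (simp add: X1_space_decay)
  have "T_converges f g h \<xi>" if "\<xi> \<noteq> 0" for \<xi>
    using maj[OF that] unfolding T_converges_AE_cong[OF F G H aF aG aH] T_converges_iff_majorant[OF F G H]
    by (auto intro: le_less_trans)
  with AE_lborel_singleton[of "0 :: real ^ 2"] show ?conv
    by (intro AE_completion) (auto elim!: eventually_mono)
  have eq: "T_op f g h = T_op F G H"
    using T_op_AE_cong[OF F G H aF aG aH] by blast
  have m: "T_op f g h \<in> borel_measurable lebesgue"
    unfolding eq using T_op_measurable[OF F G H] by (simp add: measurable_completion)
  have "norm \<xi> * cmod (T_op f g h \<xi>) \<le> ?B" if "\<xi> \<noteq> 0" for \<xi>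
  proof -
    have "ennreal (cmod (T_op F G H \<xi>)) \<le> ennreal (?B / norm \<xi>)"
      using T_op_le_majorant[OF F G H] maj[OF that] by (rule order_trans)
    hence "cmod (T_op F G H \<xi>) \<le> ?B / norm \<xi>" using B0 by (subst (asm) ennreal_le_iff) auto
    thus ?thesis using that by (simp add: eq field_simps)
  qed
  with AE_lborel_singleton[of "0 :: real ^ 2"]
  have "AE \<xi> in lebesgue. ereal (norm \<xi> * cmod (T_op f g h \<xi>)) \<le> ereal ?B"
    by (intro AE_completion) (auto elim!: eventually_mono)
  hence le: "X1_enorm (T_op f g h) \<le> ereal ?B"
    unfolding X1_enorm_def
  proof (rule esssup_I[rotated])
    have [measurable]: "(norm :: real ^ 2 \<Rightarrow> real) \<in> borel_measurable lebesgue" by (simp add: measurable_completion)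
    note [measurable] = m
    show "(\<lambda>x. ereal (norm x * cmod (T_op f g h x))) \<in> borel_measurable lebesgue" by measurable
  qed
  thus ?mem using m by (auto simp: X1_space_def intro: le_less_trans)
  show ?bound
    using le X1_enorm_nonneg[OF m] B0 unfolding X1_norm_def
    by (cases "X1_enorm (T_op f g h)") auto
qed

theorem proposition2p7:
  shows "((\<forall>f\<in>L2_space. \<forall>g\<in>L2_space. \<forall>h\<in>L2_space. AE \<xi> in lebesgue. T_converges f g h \<xi>) \<and>
          bounded_trilinear_on L2_space L2_norm T_op) \<and>
         ((\<forall>f\<in>X1_space. \<forall>g\<in>X1_space. \<forall>h\<in>X1_space. AE \<xi> in lebesgue. T_converges f g h \<xi>) \<and>
          bounded_trilinear_on X1_space X1_norm T_op)"
proof (intro conjI)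
  show "\<forall>f\<in>L2_space. \<forall>g\<in>L2_space. \<forall>h\<in>L2_space. AE \<xi> in lebesgue. T_converges f g h \<xi>"
    using L2_estimate(1) by blast
  have "trilinear_on L2_space T_op"
    by (rule trilinear_on_T_op) (auto simp: L2_space_def[unfolded mem_Collect_eq] intro: L2_estimate(1))
  thus "bounded_trilinear_on L2_space L2_norm T_op"
    unfolding bounded_trilinear_on_def using L2_estimate(2,3) by blast
  show "\<forall>f\<in>X1_space. \<forall>g\<in>X1_space. \<forall>h\<in>X1_space. AE \<xi> in lebesgue. T_converges f g h \<xi>"
    using X1_estimate(1) by blast
  have "trilinear_on X1_space T_op"
    by (rule trilinear_on_T_op) (auto simp: X1_space_def intro: X1_estimate(1))
  thus "bounded_trilinear_on X1_space X1_norm T_op"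
    unfolding bounded_trilinear_on_def using X1_estimate(2,3) by blast
qed

end
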